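(* Let $d=2$ and let $u_h^{(n)}$ have DOFs $U_\kappa^{ij,n}\in[m,M]$. Let $u_h^{(n+1)}$, with DOFs $U_\kappa^{ij,n+1}\in[m,M]$, be the solution of the backward Euler DGSEM with graph viscosity $$\omega_i\omega_jJ_\kappa^{ij}\frac{U_\kappa^{ij,n+1}-U_\kappa^{ij,n}}{\Delta t^{(n)}}+R_\kappa^{ij}(u_h^{(n+1)})+V_\kappa^{ij}(u_h^{(n+1)})=0\qquad\forall\kappa\in\Omega_h,\ 0\le i,j\le p,$$ $\Delta t^{(n)}>0$, where $R_\kappa^{ij}$ is built with the entropy conservative flux $h_{ec}$ associated with a given entropy pair $(\vartheta,\mathbf g)$ with $\vartheta''>0$, and $$d_\kappa\ \ge\ 4L_fL_u\max_{k\ne l}\frac{|D^p_{kl}|}{\omega_l}\quad\forall\kappa\in\Omega_h,\qquad L_u:=\sup_{m\le u^+\ne u^-\le M}\frac{\vartheta''(u^+)(u^+-u^-)}{v(u^+)-v(u^-)},\quad v=\vartheta'.$$ Then for every entropy pair $(\eta,\mathbf q)$ with $\eta''\ge0$ and every $\kappa\in\Omega_h$, $$\langle\eta(u_h^{(n+1)})\rangle_\kappa\le\langle\eta(u_h^{(n)})\rangle_\kappa-\frac{\Delta t^{(n)}}{|\kappa|}\sum_{e\in\partial\kappa}\sum_{k=0}^p\omega_kJ_e^k\,Q\big(u_h^-(\mathbf x_e^k,t^{(n+1)}),u_h^+(\mathbf x_e^k,t^{(n+1)}),\mathbf n_e^k\big),$$ where $Q$ is the numerical entropy flux associated with $h$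 and $(\eta,\mathbf q)$.
   Context: **Continuous problem.** $\partial_tu+\nabla\cdot\mathbf f(u)=0$ in $\Omega\times(0,\infty)$, $u(\cdot,0)=u_0$, with $\Omega\subset\mathbb R^2$, $\mathbf f:\mathbb R\to\mathbb R^2$ locally Lipschitz, $u_0\in L^\infty$, $m:=\operatorname{ess\,inf}u_0$, $M:=\operatorname{ess\,sup}u_0$. Lipschitz constant of the flux: $L_f:=\sup_{m\le u^+\neq u^-\le M}\sup_{\mathbf n\in\mathbb S^{1}}\frac{|(\mathbf f(u^+)-\mathbf f(u^-))\cdot\mathbf n|}{|u^+-u^-|}$. An entropy pair $(\eta,\mathbf q)$ means $\eta$ convex and $\mathbf q(u)=\int^u\eta'(w)\mathbf f'(w)\,dw$. **One-dimensional operators.** $p\ge1$; $-1=\xi_0<\dots<\xi_p=1$ are the Gauss-Lobatto nodes on $I=[-1,1]$, $\omega_k>0$ the associated quadrature weights ($\sum_k\omega_k=2$), $\ell_k$ the Lagrange polynomials with $\ell_k(\xi_l)=\delta_{kl}$; $D^p_{kl}=\ell_l'(\xi_k)$, $Q^p_{kl}=\omega_kD^p_{kl}$ for $0\le k,l\le p$. **Mesh.** $\Omega_h$ is a mesh of nonoverlapping nonempty open elements $\kappa$ partitioning $\Omega$ (possibly countably infinitely many). Each $\kappa$ is the image of $I^2$ under a mapping $\mathbf x_\kappa(\xi,\zeta)=\sum_{i,j=0}^p\ell_i(\xi)\ell_j(\zeta)\mathbf x_\kappa^{ij}$, with $\mathbf x_\kappa^{ij}=\mathbf x_\kappa(\xi_i,\xi_j)$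 and $J_\kappa^{ij}=\det\mathbf x_\kappa'(\xi_i,\xi_j)>0$. Each edge $e\subset\partial\kappa$ is the image of $I$ under $\mathbf x_e$; $\mathbf x_e^k=\mathbf x_e(\xi_k)$, $J_e^k=|\mathbf x_e'(\xi_k)|>0$, $\mathbf n_e^k$ is the unit normal to $e$ at $\mathbf x_e^k$ pointing outward from $\kappa$. Metric terms ($\nabla\xi,\nabla\zeta$ are the physical gradients of the reference coordinates): $\mathbf n_\kappa^{(ik)j}=\frac12\big(J_\kappa^{ij}\nabla\xi(\xi_i,\xi_j)+J_\kappa^{kj}\nabla\xi(\xi_k,\xi_j)\big)$, $\mathbf n_\kappa^{i(jk)}=\frac12\big(J_\kappa^{ij}\nabla\zeta(\xi_i,\xi_j)+J_\kappa^{ik}\nabla\zeta(\xi_i,\xi_k)\big)$. The discrete metric identities hold: $\sum_{k=0}^p D^p_{ik}\mathbf n_\kappa^{(ik)j}+D^p_{jk}\mathbf n_\kappa^{i(jk)}=0$ for all $\kappa,i,j$. The mesh is watertight (geometry continuous across faces, face nodes of neighbours coincide) and at faces $\mathbf n_\kappa^{(pp)j}=J_e\mathbf n_e$ at $\mathbf x_\kappa^{pj}$, $\mathbf n_\kappa^{(00)j}=-J_e\mathbf n_e$ at $\mathbf x_\kappa^{0j}$, $\mathbf n_\kappa^{i(pp)}=J_e\mathbf n_e$ at $\mathbf x_\kappa^{ip}$, $\mathbf n_\kappa^{i(00)}=-J_e\mathbf n_e$ at $\mathbf x_\kappa^{i0}$. Every face is shared with a neighbouring element. Mesh regularity: $h:=\sup_\kappa\operatorname{diam}\kappa<\infty$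 and there is a finite constant $b>0$ with $J_\kappa^{ij}\ge\frac{b}{2d}h^d$ and $\frac1{4db}h^{d-1}\ge J_e^k,|\mathbf n_\kappa^{(ik)j}|,|\mathbf n_\kappa^{i(jk)}|>0$ for all $\kappa,i,j,k$ (here $d=2$). **Discrete functions.** $u_h|_\kappa=\sum_{i,j=0}^p\phi_\kappa^{ij}U_\kappa^{ij}$ with $\phi_\kappa^{ij}(\mathbf x_\kappa(\xi,\zeta))=\ell_i(\xi)\ell_j(\zeta)$, so $U_\kappa^{ij}$ is the value of $u_h$ in $\kappa$ at $\mathbf x_\kappa^{ij}$. At a face node $\mathbf x_e^k$, $e\subset\partial\kappa$, $u_h^-$ is the trace from $\kappa$ and $u_h^+$ the trace from the neighbour; $\phi_\kappa^{ij}(\mathbf x_e^k)=1$ if $\mathbf x_\kappa^{ij}=\mathbf x_e^k$ and $0$ otherwise. Initial DOFs: $U_\kappa^{ij,0}=u_0(\mathbf x_\kappa^{ij})\in[m,M]$. Cell average (by quadrature): $|\kappa|=\sum_{i,j}\omega_i\omega_jJ_\kappa^{ij}$, $\langle\eta(u_h)\rangle_\kappa=\sum_{0\le i,j\le p}\omega_i\omega_j\frac{J_\kappa^{ij}}{|\kappa|}\eta(U_\kappa^{ij})$. **Residual and graph viscosity.** $$R_\kappa^{ij}(u_h)=2\Big(\omega_j\sum_{k=0}^pQ^p_{ik}h_{ec}(U_\kappa^{ij},U_\kappa^{kj},\mathbf n_\kappa^{(ik)j})+\omega_i\sum_{k=0}^pQ^p_{jk}h_{ec}(U_\kappa^{ij},U_\kappa^{ik},\mathbf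 n_\kappa^{i(jk)})\Big)+\sum_{e\in\partial\kappa}\sum_{k=0}^p\phi_\kappa^{ij}(\mathbf x_e^k)\omega_kJ_e^k\Big(h(U_\kappa^{ij},u_h^+(\mathbf x_e^k),\mathbf n_e^k)-\mathbf f(U_\kappa^{ij})\cdot\mathbf n_e^k\Big),$$ $$V_\kappa^{ij}(u_h)=d_\kappa\omega_i\omega_j\sum_{k=0}^p\Big(\frac{\omega_k}2|\mathbf n_\kappa^{(ik)j}|(U_\kappa^{ij}-U_\kappa^{kj})+\frac{\omega_k}2|\mathbf n_\kappa^{i(jk)}|(U_\kappa^{ij}-U_\kappa^{ik})\Big).$$ **Cell flux $h_{ec}$.** With $\mathbf g(u)=\int^u\vartheta'(w)\mathbf f'(w)\,dw$, $v(u)=\vartheta'(u)$ and $\boldsymbol\psi(u)=v(u)\mathbf f(u)-\mathbf g(u)$, $h_{ec}$ is smooth, consistent ($h_{ec}(u,u,\mathbf n)=\mathbf f(u)\cdot\mathbf n$), symmetric in its first two arguments, linear in $\mathbf n\in\mathbb R^2$, and entropy conservative: $(v(u^+)-v(u^-))h_{ec}(u^-,u^+,\mathbf n)=(\boldsymbol\psi(u^+)-\boldsymbol\psi(u^-))\cdot\mathbf n$. **Interface flux $h$ and entropy flux $Q$.** $h$ is Lipschitz continuous, consistent ($h(u,u,\mathbf n)=\mathbf f(u)\cdot\mathbf n$), conservative ($h(u^-,u^+,\mathbf n)=-h(u^+,u^-,-\mathbf n)$), and monotone (nondecreasing in $u^-$, nonincreasing in $u^+$); its Lipschitz constants $L_1,L_2$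 in its first two arguments satisfy $L_1+L_2\ge L_f$. For all $u^-,u,u^+\in[m,M]$, $\mathbf n\in\mathbb S^1$, $\alpha\ge L_f$: $m\le u-\frac{h(u,u^+,\mathbf n)-h(u^-,u,\mathbf n)}{2\alpha}\le M$, and for each convex entropy pair $(\eta,\mathbf q)$, $\eta\big(u-\frac{h(u,u^+,\mathbf n)-h(u^-,u,\mathbf n)}{2\alpha}\big)\le\eta(u)-\frac{Q(u,u^+,\mathbf n)-Q(u^-,u,\mathbf n)}{2\alpha}$, where $Q$ is the associated numerical entropy flux, consistent ($Q(u,u,\mathbf n)=\mathbf q(u)\cdot\mathbf n$) and conservative ($Q(u^-,u^+,\mathbf n)=-Q(u^+,u^-,-\mathbf n)$). *)

theory Defs
  imports
    "HOL-Analysis.Analysis"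
    "HOL-Computational_Algebra.Polynomial"
    "HOL-Probability.Essential_Supremum"
begin

section \<open>Flux, entropy pairs, numerical fluxes\<close>

definition locally_lipschitz :: "('a::metric_space \<Rightarrow> 'b::metric_space) \<Rightarrow> bool" where
  "locally_lipschitz f \<longleftrightarrow> (\<forall>u. \<exists>\<epsilon>>0. \<exists>L. L-lipschitz_on (ball u \<epsilon>) f)"

text \<open>\<open>u0\<close> is an essentially bounded function on \<open>\<Omega>\<close> with (finite) essential infimum \<open>m\<close> and
  essential supremum \<open>M\<close>.\<close>

definition essential_bounds :: "(real^2) set \<Rightarrow> (real^2 \<Rightarrow> real) \<Rightarrow> real \<Rightarrow> real \<Rightarrow> bool" where
  "essential_bounds \<Omega> u0 m M \<longleftrightarrow>
     \<Omega> \<in> sets lebesgue \<and>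
     u0 \<in> borel_measurable (lebesgue_on \<Omega>) \<and>
     ereal m = - esssup (lebesgue_on \<Omega>) (\<lambda>x. - ereal (u0 x)) \<and>
     ereal M = esssup (lebesgue_on \<Omega>) (\<lambda>x. ereal (u0 x))"

text \<open>The two suprema \<open>L_f\<close> and \<open>L_u\<close> are taken in the extended reals. Both range over nonnegative
  quantities; \<open>max 0\<close> only matters for \<open>m = M\<close>, where the index set is empty.\<close>

definition flux_lipschitz :: "(real \<Rightarrow> real^2) \<Rightarrow> real \<Rightarrow> real \<Rightarrow> ereal" where
  "flux_lipschitz f m M =
     max 0 (Sup {ereal (\<bar>(f a - f b) \<bullet> n\<bar> / \<bar>a - b\<bar>) | a b n.
                   a \<in> {m..M} \<and> b \<in> {m..M} \<and> a \<noteq> b \<and> norm n = 1})"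

definition entropy_ratio :: "(real \<Rightarrow> real) \<Rightarrow> real \<Rightarrow> real \<Rightarrow> ereal" where
  "entropy_ratio \<theta> m M =
     max 0 (Sup {ereal (deriv (deriv \<theta>) a * (a - b) / (deriv \<theta> a - deriv \<theta> b)) | a b.
                   a \<in> {m..M} \<and> b \<in> {m..M} \<and> a \<noteq> b})"

text \<open>For a merely convex \<open>\<eta>\<close> and a merely locally Lipschitz \<open>f\<close> the derivatives below exist almost
  everywhere only; the integral does not see the values at the exceptional points.
  The base point of the primitive is left open.\<close>

definition entropy_pair :: "(real \<Rightarrow> real^2) \<Rightarrow> (real \<Rightarrow> real) \<Rightarrow> (real \<Rightarrow> real^2) \<Rightarrow> bool" where
  "entropy_pair f \<eta> q \<longleftrightarrow>
     convex_on UNIV \<eta> \<and>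
     (\<forall>a b. a \<le> b \<longrightarrow>
        ((\<lambda>w. deriv \<eta> w *\<^sub>R vector_derivative f (at w)) has_integral (q b - q a)) {a..b})"

definition twice_differentiable :: "(real \<Rightarrow> real) \<Rightarrow> bool" where
  "twice_differentiable \<eta> \<longleftrightarrow>
     (\<forall>w. \<eta> differentiable (at w)) \<and> (\<forall>w. deriv \<eta> differentiable (at w))"

text \<open>\<open>C_k k F\<close>: all iterated directional derivatives of order \<open>\<le> k\<close> exist and are continuous;
  in finite dimension this is \<open>k\<close>-fold continuous differentiability.\<close>

fun C_k :: "nat \<Rightarrow> ('a::euclidean_space \<Rightarrow> 'b::real_normed_vector) \<Rightarrow> bool" where
  "C_k 0 F \<longleftrightarrow> continuous_on UNIV F"
| "C_k (Suc k) F \<longleftrightarrow>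
     (\<forall>x. F differentiable (at x)) \<and> (\<forall>v. C_k k (\<lambda>x. frechet_derivative F (at x) v))"

definition smooth :: "('a::euclidean_space \<Rightarrow> 'b::real_normed_vector) \<Rightarrow> bool" where
  "smooth F \<longleftrightarrow> (\<forall>k. C_k k F)"

definition entropy_potential ::
  "(real \<Rightarrow> real^2) \<Rightarrow> (real \<Rightarrow> real) \<Rightarrow> (real \<Rightarrow> real^2) \<Rightarrow> real \<Rightarrow> real^2" where
  "entropy_potential f \<theta> g u = deriv \<theta> u *\<^sub>R f u - g u"

definition entropy_conservative_flux ::
  "(real \<Rightarrow> real^2) \<Rightarrow> (real \<Rightarrow> real) \<Rightarrow> (real \<Rightarrow> real^2) \<Rightarrow>
   (real \<Rightarrow> real \<Rightarrow> real^2 \<Rightarrow> real) \<Rightarrow> bool" where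
  "entropy_conservative_flux f \<theta> g hec \<longleftrightarrow>
     smooth (\<lambda>(a, b, n). hec a b n) \<and>
     (\<forall>u n. hec u u n = f u \<bullet> n) \<and>
     (\<forall>a b n. hec a b n = hec b a n) \<and>
     (\<forall>a b. linear (hec a b)) \<and>
     (\<forall>a b n. (deriv \<theta> b - deriv \<theta> a) * hec a b n =
        (entropy_potential f \<theta> g b - entropy_potential f \<theta> g a) \<bullet> n)"

definition consistent_flux ::
  "(real \<Rightarrow> real^2) \<Rightarrow> real \<Rightarrow> real \<Rightarrow> (real \<Rightarrow> real \<Rightarrow> real^2 \<Rightarrow> real) \<Rightarrow> bool" where
  "consistent_flux f m M h \<longleftrightarrow> (\<forall>u\<in>{m..M}. \<forall>n. norm n = 1 \<longrightarrow> h u u n = f u \<bullet> n)"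

definition conservative_flux ::
  "real \<Rightarrow> real \<Rightarrow> (real \<Rightarrow> real \<Rightarrow> real^2 \<Rightarrow> real) \<Rightarrow> bool" where
  "conservative_flux m M h \<longleftrightarrow>
     (\<forall>a\<in>{m..M}. \<forall>b\<in>{m..M}. \<forall>n. norm n = 1 \<longrightarrow> h a b n = - h b a (- n))"

definition interface_flux ::
  "(real \<Rightarrow> real^2) \<Rightarrow> real \<Rightarrow> real \<Rightarrow> (real \<Rightarrow> real \<Rightarrow> real^2 \<Rightarrow> real) \<Rightarrow> bool" where
  "interface_flux f m M h \<longleftrightarrow>
     (\<exists>L. L-lipschitz_on ({m..M} \<times> {m..M} \<times> sphere 0 1) (\<lambda>(a, b, n). h a b n)) \<and>
     (\<exists>L1 L2. (\<forall>b\<in>{m..M}. \<forall>n\<in>sphere 0 1. L1-lipschitz_on {m..M} (\<lambda>a. h a b n)) \<and>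
              (\<forall>a\<in>{m..M}. \<forall>n\<in>sphere 0 1. L2-lipschitz_on {m..M} (\<lambda>b. h a b n)) \<and>
              ereal (L1 + L2) \<ge> flux_lipschitz f m M) \<and>
     consistent_flux f m M h \<and>
     conservative_flux m M h \<and>
     (\<forall>b\<in>{m..M}. \<forall>n\<in>sphere 0 1. mono_on {m..M} (\<lambda>a. h a b n)) \<and>
     (\<forall>a\<in>{m..M}. \<forall>n\<in>sphere 0 1. antimono_on {m..M} (\<lambda>b. h a b n))"

definition three_point_update ::
  "(real \<Rightarrow> real \<Rightarrow> real^2 \<Rightarrow> real) \<Rightarrow> real \<Rightarrow> real^2 \<Rightarrow> real \<Rightarrow> real \<Rightarrow> real \<Rightarrow> real" where
  "three_point_update h \<alpha> n um u up = u - (h u up n - h um u n) / (2 * \<alpha>)"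

text \<open>\<open>Q \<eta> q\<close> is the numerical entropy flux associated with \<open>h\<close> and the pair \<open>(\<eta>, q)\<close>.
  The condition \<open>\<alpha> > 0\<close> only excludes a division by zero when \<open>L_f = 0\<close>.\<close>

definition bound_preserving_entropy_stable ::
  "(real \<Rightarrow> real^2) \<Rightarrow> real \<Rightarrow> real \<Rightarrow> (real \<Rightarrow> real \<Rightarrow> real^2 \<Rightarrow> real) \<Rightarrow>
   ((real \<Rightarrow> real) \<Rightarrow> (real \<Rightarrow> real^2) \<Rightarrow> real \<Rightarrow> real \<Rightarrow> real^2 \<Rightarrow> real) \<Rightarrow> bool" where
  "bound_preserving_entropy_stable f m M h Q \<longleftrightarrow>
     (\<forall>um\<in>{m..M}. \<forall>u\<in>{m..M}. \<forall>up\<in>{m..M}. \<forall>n\<in>sphere 0 1. \<forall>\<alpha>>0.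
        ereal \<alpha> \<ge> flux_lipschitz f m M \<longrightarrow>
          three_point_update h \<alpha> n um u up \<in> {m..M} \<and>
          (\<forall>\<eta> q. entropy_pair f \<eta> q \<longrightarrow>
             \<eta> (three_point_update h \<alpha> n um u up)
               \<le> \<eta> u - (Q \<eta> q u up n - Q \<eta> q um u n) / (2 * \<alpha>))) \<and>
     (\<forall>\<eta> q. entropy_pair f \<eta> q \<longrightarrow>
        consistent_flux q m M (Q \<eta> q) \<and> conservative_flux m M (Q \<eta> q))"


section \<open>Gauss--Lobatto collocation on \<open>[-1, 1]\<close>\<close>

text \<open>The Gauss--Lobatto rule with \<open>p + 1\<close> points: both end points are nodes, and the rule is exact
  for polynomials of degree \<open>\<le> 2 * p - 1\<close>.\<close>

definition gauss_lobatto :: "nat \<Rightarrow> (nat \<Rightarrow> real) \<Rightarrow> (nat \<Rightarrow> real) \<Rightarrow> bool" where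
  "gauss_lobatto p \<xi> \<omega> \<longleftrightarrow>
     strict_mono_on {..p} \<xi> \<and> \<xi> 0 = -1 \<and> \<xi> p = 1 \<and>
     (\<forall>k\<le>p. \<omega> k > 0) \<and>
     (\<forall>P :: real poly. degree P \<le> 2 * p - 1 \<longrightarrow>
        (poly P has_integral (\<Sum>k\<le>p. \<omega> k * poly P (\<xi> k))) {-1..1})"

text \<open>Elements are identified with the corresponding open subsets of the plane, edges with the
  corresponding closed arcs; degrees of freedom are families \<open>U \<kappa> i j\<close>.\<close>

type_synonym element = "(real^2) set"
type_synonym edge = "(real^2) set"
type_synonym dofs = "element \<Rightarrow> nat \<Rightarrow> nat \<Rightarrow> real"

record dg_space =
  ord :: nat                                       \<comment> \<open>polynomial degree \<open>p\<close>\<close>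
  gln :: "nat \<Rightarrow> real"                             \<comment> \<open>nodes \<open>\<xi>_k\<close>\<close>
  glw :: "nat \<Rightarrow> real"                             \<comment> \<open>weights \<open>\<omega>_k\<close>\<close>
  elements :: "element set"                        \<comment> \<open>the mesh \<open>\<Omega>_h\<close>\<close>
  node :: "element \<Rightarrow> nat \<Rightarrow> nat \<Rightarrow> real^2"          \<comment> \<open>\<open>x_\<kappa>^ij\<close>\<close>
  edge_map :: "edge \<Rightarrow> real \<Rightarrow> real^2"             \<comment> \<open>\<open>x_e\<close>\<close>
  normal :: "element \<Rightarrow> edge \<Rightarrow> nat \<Rightarrow> real^2"     \<comment> \<open>\<open>n_e^k\<close>, outward from the given element\<close>

definition lagrange :: "dg_space \<Rightarrow> nat \<Rightarrow> real poly" where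
  "lagrange T k = (\<Prod>l\<in>{..ord T} - {k}. smult (1 / (gln T k - gln T l)) [:- gln T l, 1:])"

definition Dmat :: "dg_space \<Rightarrow> nat \<Rightarrow> nat \<Rightarrow> real" where
  "Dmat T k l = poly (pderiv (lagrange T l)) (gln T k)"

definition Qmat :: "dg_space \<Rightarrow> nat \<Rightarrow> nat \<Rightarrow> real" where
  "Qmat T k l = glw T k * Dmat T k l"


section \<open>Curved quadrilateral meshes\<close>

definition ref_square :: "(real^2) set" where
  "ref_square = {z. \<forall>i. z $ i \<in> {-1..1}}"

definition geo_map :: "dg_space \<Rightarrow> element \<Rightarrow> real^2 \<Rightarrow> real^2" where
  "geo_map T \<kappa> z = (\<Sum>i\<le>ord T. \<Sum>j\<le>ord T.
     (poly (lagrange T i) (z $ 1) * poly (lagrange T j) (z $ 2)) *\<^sub>R node T \<kappa> i j)"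

definition geo_jacobian :: "dg_space \<Rightarrow> element \<Rightarrow> nat \<Rightarrow> nat \<Rightarrow> real^2^2" where
  "geo_jacobian T \<kappa> i j = jacobian (geo_map T \<kappa>) (at (vector [gln T i, gln T j]))"

definition Jdet :: "dg_space \<Rightarrow> element \<Rightarrow> nat \<Rightarrow> nat \<Rightarrow> real" where
  "Jdet T \<kappa> i j = det (geo_jacobian T \<kappa> i j)"

text \<open>The physical gradients of the reference coordinates \<open>\<xi>\<close>, \<open>\<zeta>\<close> are the rows of the inverse of the
  Jacobian matrix of the element map.\<close>

definition grad_xi :: "dg_space \<Rightarrow> element \<Rightarrow> nat \<Rightarrow> nat \<Rightarrow> real^2" where
  "grad_xi T \<kappa> i j = row 1 (matrix_inv (geo_jacobian T \<kappa> i j))"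

definition grad_zeta :: "dg_space \<Rightarrow> element \<Rightarrow> nat \<Rightarrow> nat \<Rightarrow> real^2" where
  "grad_zeta T \<kappa> i j = row 2 (matrix_inv (geo_jacobian T \<kappa> i j))"

text \<open>\<open>metric_xi T \<kappa> i k j\<close> is \<open>n_\<kappa>^(ik)j\<close> and \<open>metric_zeta T \<kappa> i j k\<close> is \<open>n_\<kappa>^i(jk)\<close>.\<close>

definition metric_xi :: "dg_space \<Rightarrow> element \<Rightarrow> nat \<Rightarrow> nat \<Rightarrow> nat \<Rightarrow> real^2" where
  "metric_xi T \<kappa> i k j =
     (1/2) *\<^sub>R (Jdet T \<kappa> i j *\<^sub>R grad_xi T \<kappa> i j + Jdet T \<kappa> k j *\<^sub>R grad_xi T \<kappa> k j)"

definition metric_zeta :: "dg_space \<Rightarrow> element \<Rightarrow> nat \<Rightarrow> nat \<Rightarrow> nat \<Rightarrow> real^2" where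
  "metric_zeta T \<kappa> i j k =
     (1/2) *\<^sub>R (Jdet T \<kappa> i j *\<^sub>R grad_zeta T \<kappa> i j + Jdet T \<kappa> i k *\<^sub>R grad_zeta T \<kappa> i k)"

text \<open>The side of an element on which the reference coordinate number \<open>c\<close> equals \<open>s\<close>.\<close>

definition side :: "dg_space \<Rightarrow> element \<Rightarrow> 2 \<Rightarrow> real \<Rightarrow> edge" where
  "side T \<kappa> c s = geo_map T \<kappa> ` {z \<in> ref_square. z $ c = s}"

definition edges :: "dg_space \<Rightarrow> element \<Rightarrow> edge set" where
  "edges T \<kappa> = {side T \<kappa> 1 (-1), side T \<kappa> 1 1, side T \<kappa> 2 (-1), side T \<kappa> 2 1}"

definition edge_node :: "dg_space \<Rightarrow> edge \<Rightarrow> nat \<Rightarrow> real^2" where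
  "edge_node T e k = edge_map T e (gln T k)"

definition edge_tangent :: "dg_space \<Rightarrow> edge \<Rightarrow> nat \<Rightarrow> real^2" where
  "edge_tangent T e k = vector_derivative (edge_map T e) (at (gln T k) within {-1..1})"

definition Jedge :: "dg_space \<Rightarrow> edge \<Rightarrow> nat \<Rightarrow> real" where
  "Jedge T e k = norm (edge_tangent T e k)"

definition neighbour :: "dg_space \<Rightarrow> element \<Rightarrow> edge \<Rightarrow> element" where
  "neighbour T \<kappa> e = (THE \<kappa>'. \<kappa>' \<in> elements T \<and> \<kappa>' \<noteq> \<kappa> \<and> e \<in> edges T \<kappa>')"

definition partitions :: "dg_space \<Rightarrow> (real^2) set \<Rightarrow> bool" where
  "partitions T \<Omega> \<longleftrightarrow>
     countable (elements T) \<and> disjoint (elements T) \<and>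
     \<Union> (elements T) \<subseteq> \<Omega> \<and> \<Omega> \<subseteq> (\<Union>\<kappa>\<in>elements T. closure \<kappa>) \<and>
     (\<forall>\<kappa>\<in>elements T. open \<kappa> \<and> \<kappa> \<noteq> {})"

text \<open>The element map is required to be injective on the closed reference square; this is implicit in
  the definition of the basis functions on the physical element. The map sends the open square onto
  the (open) element and hence the closed square onto its closure.\<close>

definition valid_elements :: "dg_space \<Rightarrow> bool" where
  "valid_elements T \<longleftrightarrow> (\<forall>\<kappa>\<in>elements T.
     inj_on (geo_map T \<kappa>) ref_square \<and>
     geo_map T \<kappa> ` interior ref_square = \<kappa> \<and>
     (\<forall>i\<le>ord T. \<forall>j\<le>ord T. Jdet T \<kappa> i j > 0))"

definition valid_edges :: "dg_space \<Rightarrow> bool" where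
  "valid_edges T \<longleftrightarrow> (\<forall>\<kappa>\<in>elements T. \<forall>e\<in>edges T \<kappa>.
     edge_map T e ` {-1..1} = e \<and>
     (\<forall>t\<in>{-1..1}. edge_map T e differentiable (at t within {-1..1})) \<and>
     (\<forall>k\<le>ord T.
        Jedge T e k > 0 \<and>
        norm (normal T \<kappa> e k) = 1 \<and>
        normal T \<kappa> e k \<bullet> edge_tangent T e k = 0 \<and>
        (\<forall>\<^sub>F t in at_right 0. edge_node T e k + t *\<^sub>R normal T \<kappa> e k \<notin> closure \<kappa>)))"

text \<open>Since an edge carries one parametrization for both adjacent elements, the nodes of an edge agree
  with those of an adjacent element up to orientation only.\<close>

definition nodes_match :: "dg_space \<Rightarrow> edge \<Rightarrow> (nat \<Rightarrow> real^2) \<Rightarrow> bool" where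
  "nodes_match T e x \<longleftrightarrow>
     (\<forall>k\<le>ord T. edge_node T e k = x k) \<or> (\<forall>k\<le>ord T. edge_node T e k = x (ord T - k))"

text \<open>Conforming, watertight mesh without boundary faces: every edge of an element is, as a set, an edge
  of exactly one other element, and the nodes on it coincide.\<close>

definition watertight :: "dg_space \<Rightarrow> bool" where
  "watertight T \<longleftrightarrow> (\<forall>\<kappa>\<in>elements T.
     (\<forall>e\<in>edges T \<kappa>. \<exists>!\<kappa>'. \<kappa>' \<in> elements T \<and> \<kappa>' \<noteq> \<kappa> \<and> e \<in> edges T \<kappa>') \<and>
     nodes_match T (side T \<kappa> 1 (-1)) (\<lambda>j. node T \<kappa> 0 j) \<and>
     nodes_match T (side T \<kappa> 1 1) (\<lambda>j. node T \<kappa> (ord T) j) \<and>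
     nodes_match T (side T \<kappa> 2 (-1)) (\<lambda>i. node T \<kappa> i 0) \<and>
     nodes_match T (side T \<kappa> 2 1) (\<lambda>i. node T \<kappa> i (ord T)))"

definition face_metric_compatible :: "dg_space \<Rightarrow> bool" where
  "face_metric_compatible T \<longleftrightarrow> (let p = ord T in
     \<forall>\<kappa>\<in>elements T. \<forall>i\<le>p. \<forall>k\<le>p.
       (let e = side T \<kappa> 1 1 in edge_node T e k = node T \<kappa> p i \<longrightarrow>
          metric_xi T \<kappa> p p i = Jedge T e k *\<^sub>R normal T \<kappa> e k) \<and>
       (let e = side T \<kappa> 1 (-1) in edge_node T e k = node T \<kappa> 0 i \<longrightarrow>
          metric_xi T \<kappa> 0 0 i = - (Jedge T e k *\<^sub>R normal T \<kappa> e k)) \<and>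
       (let e = side T \<kappa> 2 1 in edge_node T e k = node T \<kappa> i p \<longrightarrow>
          metric_zeta T \<kappa> i p p = Jedge T e k *\<^sub>R normal T \<kappa> e k) \<and>
       (let e = side T \<kappa> 2 (-1) in edge_node T e k = node T \<kappa> i 0 \<longrightarrow>
          metric_zeta T \<kappa> i 0 0 = - (Jedge T e k *\<^sub>R normal T \<kappa> e k)))"

definition discrete_metric_identities :: "dg_space \<Rightarrow> bool" where
  "discrete_metric_identities T \<longleftrightarrow>
     (\<forall>\<kappa>\<in>elements T. \<forall>i\<le>ord T. \<forall>j\<le>ord T.
        (\<Sum>k\<le>ord T. Dmat T i k *\<^sub>R metric_xi T \<kappa> i k j + Dmat T j k *\<^sub>R metric_zeta T \<kappa> i j k) = 0)"

definition mesh_size :: "dg_space \<Rightarrow> real" where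
  "mesh_size T = (SUP \<kappa>\<in>elements T. diameter \<kappa>)"

text \<open>The bounds are \<open>J \<ge> b / (2 d) h ^ d\<close> and \<open>h ^ (d - 1) / (4 d b) \<ge> J_e, |n| > 0\<close>
  with \<open>d = 2\<close>.\<close>

definition regular_mesh :: "dg_space \<Rightarrow> bool" where
  "regular_mesh T \<longleftrightarrow>
     bdd_above (diameter ` elements T) \<and>
     (\<exists>b>0. \<forall>\<kappa>\<in>elements T. \<forall>i\<le>ord T. \<forall>j\<le>ord T. \<forall>k\<le>ord T.
        Jdet T \<kappa> i j \<ge> b / (2 * 2) * mesh_size T ^ 2 \<and>
        (\<forall>e\<in>edges T \<kappa>. Jedge T e k \<in> {0 <.. 1 / (4 * 2 * b) * mesh_size T}) \<and>
        norm (metric_xi T \<kappa> i k j) \<in> {0 <.. 1 / (4 * 2 * b) * mesh_size T} \<and>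
        norm (metric_zeta T \<kappa> i j k) \<in> {0 <.. 1 / (4 * 2 * b) * mesh_size T})"

definition dg_mesh :: "dg_space \<Rightarrow> (real^2) set \<Rightarrow> bool" where
  "dg_mesh T \<Omega> \<longleftrightarrow>
     partitions T \<Omega> \<and> valid_elements T \<and> valid_edges T \<and> watertight T \<and>
     face_metric_compatible T \<and> discrete_metric_identities T \<and> regular_mesh T"


section \<open>Discrete functions and the DGSEM residual\<close>

text \<open>Both are meant for points of the closure of \<open>\<kappa>\<close>; on an edge, \<open>discrete_fun\<close> is the trace from
  \<open>\<kappa>\<close>.\<close>

definition basis_fun :: "dg_space \<Rightarrow> element \<Rightarrow> nat \<Rightarrow> nat \<Rightarrow> real^2 \<Rightarrow> real" where
  "basis_fun T \<kappa> i j x = (let z = inv_into ref_square (geo_map T \<kappa>) x in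
     poly (lagrange T i) (z $ 1) * poly (lagrange T j) (z $ 2))"

definition discrete_fun :: "dg_space \<Rightarrow> dofs \<Rightarrow> element \<Rightarrow> real^2 \<Rightarrow> real" where
  "discrete_fun T U \<kappa> x = (\<Sum>i\<le>ord T. \<Sum>j\<le>ord T. basis_fun T \<kappa> i j x * U \<kappa> i j)"

definition inner_trace :: "dg_space \<Rightarrow> dofs \<Rightarrow> element \<Rightarrow> edge \<Rightarrow> nat \<Rightarrow> real" where
  "inner_trace T U \<kappa> e k = discrete_fun T U \<kappa> (edge_node T e k)"

definition outer_trace :: "dg_space \<Rightarrow> dofs \<Rightarrow> element \<Rightarrow> edge \<Rightarrow> nat \<Rightarrow> real" where
  "outer_trace T U \<kappa> e k = discrete_fun T U (neighbour T \<kappa> e) (edge_node T e k)"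

definition dofs_in :: "dg_space \<Rightarrow> real set \<Rightarrow> dofs \<Rightarrow> bool" where
  "dofs_in T S U \<longleftrightarrow> (\<forall>\<kappa>\<in>elements T. \<forall>i\<le>ord T. \<forall>j\<le>ord T. U \<kappa> i j \<in> S)"

definition cell_volume :: "dg_space \<Rightarrow> element \<Rightarrow> real" where
  "cell_volume T \<kappa> = (\<Sum>i\<le>ord T. \<Sum>j\<le>ord T. glw T i * glw T j * Jdet T \<kappa> i j)"

definition cell_average :: "dg_space \<Rightarrow> (real \<Rightarrow> real) \<Rightarrow> dofs \<Rightarrow> element \<Rightarrow> real" where
  "cell_average T \<eta> U \<kappa> = (\<Sum>i\<le>ord T. \<Sum>j\<le>ord T.
     glw T i * glw T j * (Jdet T \<kappa> i j / cell_volume T \<kappa>) * \<eta> (U \<kappa> i j))"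

definition residual ::
  "dg_space \<Rightarrow> (real \<Rightarrow> real^2) \<Rightarrow> (real \<Rightarrow> real \<Rightarrow> real^2 \<Rightarrow> real) \<Rightarrow>
   (real \<Rightarrow> real \<Rightarrow> real^2 \<Rightarrow> real) \<Rightarrow> dofs \<Rightarrow> element \<Rightarrow> nat \<Rightarrow> nat \<Rightarrow> real" where
  "residual T f hec h U \<kappa> i j =
     2 * (glw T j * (\<Sum>k\<le>ord T. Qmat T i k * hec (U \<kappa> i j) (U \<kappa> k j) (metric_xi T \<kappa> i k j))
        + glw T i * (\<Sum>k\<le>ord T. Qmat T j k * hec (U \<kappa> i j) (U \<kappa> i k) (metric_zeta T \<kappa> i j k)))
     + (\<Sum>e\<in>edges T \<kappa>. \<Sum>k\<le>ord T.
          basis_fun T \<kappa> i j (edge_node T e k) * glw T k * Jedge T e k *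
            (h (U \<kappa> i j) (outer_trace T U \<kappa> e k) (normal T \<kappa> e k)
               - f (U \<kappa> i j) \<bullet> normal T \<kappa> e k))"

definition graph_viscosity ::
  "dg_space \<Rightarrow> (element \<Rightarrow> real) \<Rightarrow> dofs \<Rightarrow> element \<Rightarrow> nat \<Rightarrow> nat \<Rightarrow> real" where
  "graph_viscosity T d U \<kappa> i j =
     d \<kappa> * glw T i * glw T j * (\<Sum>k\<le>ord T.
       glw T k / 2 * norm (metric_xi T \<kappa> i k j) * (U \<kappa> i j - U \<kappa> k j)
       + glw T k / 2 * norm (metric_zeta T \<kappa> i j k) * (U \<kappa> i j - U \<kappa> i k))"

definition max_D_ratio :: "dg_space \<Rightarrow> real" where
  "max_D_ratio T = Max {\<bar>Dmat T k l\<bar> / glw T l | k l. k \<le> ord T \<and> l \<le> ord T \<and> k \<noteq> l}"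

end

theory Submission
  imports Defs
begin

text \<open>The interface terms are controlled by the three-point entropy inequality. For the volume terms put
  \<open>\<psi> = \<eta>' f - q\<close>: summation by parts, the metric identities and the graph viscosity reduce the claim to
  \<open>\<bar>(\<eta>'(a) - \<eta>'(b)) hec a b n - (\<psi> a - \<psi> b) \<bullet> n\<bar> \<le> L\<^sub>f |n| (\<eta>'(a) - \<eta>'(b)) (a - b)\<close> for each pair of nodes on a
  line. Since \<open>\<psi>' = \<eta>'' f\<close>, Cauchy's mean value theorem for \<open>\<theta>\<close> gives \<open>hec a b n = f c \<bullet> n\<close> with \<open>c\<close> between \<open>a\<close>
  and \<open>b\<close>, and the estimate follows by integrating \<open>\<eta>'' (hec a b n - f \<bullet> n)\<close>. The factor \<open>L\<^sub>u\<close> only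
  enters through \<open>L\<^sub>u \<ge> 1\<close>.\<close>

section \<open>Gauss--Lobatto rules and summation by parts\<close>

text \<open>The obstacle is that \<open>hec\<close> conserves only the entropy
  \<open>\<theta>\<close>, while the scheme is tested with the derivative of an arbitrary
  \<open>\<eta>\<close>. Building the potential from \<open>\<eta>\<close> concentrates the loss in
  one defect per pair of nodes. By the metric identities a term that depends on the node alone
  contributes nothing to the volume sums, so \<open>\<psi>\<close> can be subtracted at no cost. On
  the diagonal \<open>\<eta>' f - \<psi> = q\<close>, hence the endpoint terms left by summation by
  parts are entropy fluxes through the faces, and there the interface inequality exchanges
  \<open>q\<close> for \<open>Q\<close>. The constant 4 is 2 times 2: one factor 1/2 is written into
  the graph viscosity, the other appears when its sum is symmetrised over pairs of nodes. A node
  paired with itself has no defect, which matches the maximum over distinct indices in the bound for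
  \<open>d\<close>. The time step is unrestricted because convexity enters through the tangent at
  the new state, the same state at which the residual is evaluated.\<close>

lemma gauss_lobatto_inj:
  assumes "gauss_lobatto p \<xi> \<omega>"
  shows "inj_on \<xi> {..p}"
  using assms by (simp add: gauss_lobatto_def strict_mono_on_imp_inj_on)

lemma gauss_lobatto_nodes_bounded:
  assumes "gauss_lobatto p \<xi> \<omega>" "k \<le> p"
  shows "\<xi> k \<in> {-1..1}"
proof -
  have "mono_on {..p} \<xi>" "\<xi> 0 = -1" "\<xi> p = 1"
    using assms by (auto simp: gauss_lobatto_def intro: strict_mono_on_imp_mono_on)
  then show ?thesis
    using assms(2) monotone_onD[of "{..p}" "(\<le>)" "(\<le>)" \<xi> 0 k] monotone_onD[of "{..p}" "(\<le>)" "(\<le>)" \<xi> k p]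
    by auto
qed

lemma gauss_lobatto_pos:
  assumes "gauss_lobatto p \<xi> \<omega>" "k \<le> p"
  shows "\<omega> k > 0"
  using assms by (simp add: gauss_lobatto_def)

lemma gauss_lobatto_exact:
  assumes "gauss_lobatto p \<xi> \<omega>" "degree P \<le> 2 * p - 1"
  shows "(poly P has_integral (\<Sum>k\<le>p. \<omega> k * poly P (\<xi> k))) {-1..1}"
  using assms by (simp add: gauss_lobatto_def)

text \<open>Substitute \<open>x\<close> by \<open>-x\<close> in the integral and list the nodes
  backwards to keep them increasing. Comparison of this rule with the original one yields the
  symmetry of nodes and weights.\<close>

lemma gauss_lobatto_reflect:
  assumes "gauss_lobatto p \<xi> \<omega>"
  shows "gauss_lobatto p (\<lambda>k. - \<xi> (p - k)) (\<lambda>k. \<omega> (p - k))"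
proof -
  have "strict_mono_on {..p} (\<lambda>k. - \<xi> (p - k))"
    using assms by (auto simp: gauss_lobatto_def monotone_on_def)
  moreover have "(poly P has_integral (\<Sum>k\<le>p. \<omega> (p - k) * poly P (- \<xi> (p - k)))) {-1..1}"
    if "degree P \<le> 2 * p - 1" for P
  proof -
    have "degree (P \<circ>\<^sub>p [:0, -1:]) \<le> 2 * p - 1"
      using that by (simp add: degree_pcompose)
    then have "(poly (P \<circ>\<^sub>p [:0, -1:]) has_integral
        (\<Sum>k\<le>p. \<omega> k * poly (P \<circ>\<^sub>p [:0, -1:]) (\<xi> k))) {-1..1}"
      by (rule gauss_lobatto_exact[OF assms])
    then have "((\<lambda>x. poly P (- x)) has_integral (\<Sum>k\<le>p. \<omega> k * poly P (- \<xi> k))) {-1..1}"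
      by (simp add: poly_pcompose[abs_def])
    then have "((\<lambda>x. poly P x) has_integral (\<Sum>k\<le>p. \<omega> k * poly P (- \<xi> k))) {-1..1}"
      using has_integral_reflect_real[where a = "-1" and b = 1 and f = "poly P"] by simp
    moreover have "(\<Sum>k\<le>p. \<omega> (p - k) * poly P (- \<xi> (p - k))) = (\<Sum>k\<le>p. \<omega> k * poly P (- \<xi> k))"
      by (rule sum.reindex_bij_witness[of _ "\<lambda>k. p - k" "\<lambda>k. p - k"]) auto
    ultimately show ?thesis by simp
  qed
  ultimately show ?thesis
    using assms by (auto simp: gauss_lobatto_def)
qed

text \<open>The difference of two node polynomials is \<open>(x\<^sup>2 - 1) E\<close> with \<open>degree E \<le> p - 2\<close>; each node
  polynomial is orthogonal to \<open>E\<close> (both rules are exact and vanish), so the integral of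
  \<open>(x\<^sup>2 - 1) E\<^sup>2\<close> is zero.\<close>

lemma gauss_lobatto_nodes_unique:
  assumes gl: "gauss_lobatto p \<xi> \<omega>" and gl': "gauss_lobatto p \<xi>' \<omega>'" and p: "p \<ge> 1"
    and k: "k \<le> p"
  shows "\<xi> k = \<xi>' k"
\<comment> \<open>For \<open>p = 1\<close> there are no interior nodes, and the degree bound
  \<open>p - 2\<close> below would be spoilt by truncated subtraction.\<close>
proof (cases "p = 1")
  case True
  then have "k = 0 \<or> k = p" using k by auto
  with gl gl' show ?thesis by (auto simp: gauss_lobatto_def)
next
  case False
  with p have p2: "p \<ge> 2" by simp
  define N :: "(nat \<Rightarrow> real) \<Rightarrow> real poly" where "N x = (\<Prod>l\<in>{1..<p}. [:- x l, 1:])" for x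
  define w :: "real poly" where "w = [:-1, 0, 1:]"
  have degN: "degree (N x) = p - 1" for x
    unfolding N_def by (subst degree_prod_eq_sum_degree) auto
  have leadN: "coeff (N x) (p - 1) = 1" for x
  proof -
    have "lead_coeff (N x) = 1" unfolding N_def by (simp add: lead_coeff_prod)
    then show ?thesis by (simp add: degN)
  qed
  have wN0: "poly (w * N x) (x i) = 0" if "gauss_lobatto p x v" "i \<le> p" for x v i
  proof (cases "i = 0 \<or> i = p")
    case True
    then show ?thesis using that by (auto simp: w_def gauss_lobatto_def)
  next
    case False
    then have "i \<in> {1..<p}" using that by auto
    then show ?thesis by (auto simp: N_def poly_prod intro!: prod_zero)
  qed
  \<comment> \<open>Both interior node polynomials are monic of degree \<open>p - 1\<close>, so the
    leading terms cancel; the end points sit in the common factor \<open>w\<close>.\<close>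
  define E where "E = N \<xi> - N \<xi>'"
  have degE: "degree E \<le> p - 2"
  proof -
    have "degree E \<le> p - 1" unfolding E_def by (intro degree_diff_le) (simp_all add: degN)
    moreover have "coeff E (p - 1) = 0" by (simp only: E_def coeff_diff leadN diff_self)
    ultimately have "degree E < p - 1 \<or> E = 0"
      by (metis leading_coeff_0_iff le_neq_implies_less)
    then show ?thesis using p2 by auto
  qed
  have degw: "degree w = 2" by (simp add: w_def)
  \<comment> \<open>The degree is at most \<open>2 + (p - 1) + (p - 2) = 2 * p - 1\<close>, exactly
    the limit of exactness.\<close>
  have int0: "(poly (w * N x * E) has_integral 0) {-1..1}" if "gauss_lobatto p x v" for x v
  proof -
    have "degree (w * N x * E) \<le> 2 + (p - 1) + (p - 2)"
      using degree_mult_le[of "w * N x" E] degree_mult_le[of w "N x"] degE degN[of x] degw by linarith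
    then have "degree (w * N x * E) \<le> 2 * p - 1" using p2 by linarith
    from gauss_lobatto_exact[OF that this]
    have "(poly (w * N x * E) has_integral (\<Sum>k\<le>p. v k * poly (w * N x * E) (x k))) {-1..1}" .
    moreover have "(\<Sum>k\<le>p. v k * poly (w * N x * E) (x k)) = 0"
      using wN0[OF that] by (intro sum.neutral) auto
    ultimately show ?thesis by simp
  qed
  have wE: "w * E * E = w * N \<xi> * E - w * N \<xi>' * E" by (simp add: E_def algebra_simps)
  have "(poly (w * E * E) has_integral 0) {-1..1}"
  proof -
    have "poly (w * E * E) = (\<lambda>x. poly (w * N \<xi> * E) x - poly (w * N \<xi>' * E) x)"
      by (simp add: wE fun_eq_iff)
    then show ?thesis using has_integral_diff[OF int0[OF gl] int0[OF gl']] by (simp only: diff_self)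
  qed
  \<comment> \<open>The vanishing integral is evaluated by the first rule, which is exact here. All
    terms of the sum have the same sign, so each is zero and \<open>E\<close> has
    \<open>p - 1\<close> interior roots, one more than its degree allows.\<close>
  moreover have "degree (w * E * E) \<le> 2 * p - 1"
    using degree_mult_le[of "w * E" E] degree_mult_le[of w E] degE degw p2 by linarith
  ultimately have "(\<Sum>k\<le>p. \<omega> k * poly (w * E * E) (\<xi> k)) = 0"
    using gauss_lobatto_exact[OF gl] has_integral_unique by blast
  then have sum0: "(\<Sum>k\<le>p. \<omega> k * ((1 - (\<xi> k)\<^sup>2) * (poly E (\<xi> k))\<^sup>2)) = 0"
    by (subst (asm) neg_equal_0_iff_equal[symmetric])
      (simp add: w_def sum_negf[symmetric] power2_eq_square algebra_simps)
  have "(\<xi> k)\<^sup>2 \<le> 1" if "k \<le> p" for k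
    using gauss_lobatto_nodes_bounded[OF gl that] by (auto simp: abs_square_le_1)
  then have nonneg: "0 \<le> \<omega> k * ((1 - (\<xi> k)\<^sup>2) * (poly E (\<xi> k))\<^sup>2)" if "k \<le> p" for k
    using gauss_lobatto_pos[OF gl that] that by simp
  have roots: "poly E (\<xi> k) = 0" if "k \<in> {1..<p}" for k
  proof -
    have mono: "strict_mono_on {..p} \<xi>" using gl by (simp add: gauss_lobatto_def)
    have "\<xi> 0 < \<xi> k" "\<xi> k < \<xi> p"
      using strict_mono_onD[OF mono, of 0 k] strict_mono_onD[OF mono, of k p] that by auto
    then have "\<bar>\<xi> k\<bar> < 1" using gl by (auto simp: gauss_lobatto_def)
    then have "(\<xi> k)\<^sup>2 < 1" by (simp add: abs_square_less_1)
    moreover have "\<omega> k * ((1 - (\<xi> k)\<^sup>2) * (poly E (\<xi> k))\<^sup>2) = 0"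
      using sum0 nonneg that by (subst (asm) sum_nonneg_eq_0_iff) auto
    ultimately show ?thesis using gauss_lobatto_pos[OF gl, of k] that by auto
  qed
  have "E = 0"
  proof (rule ccontr)
    assume "E \<noteq> 0"
    have "\<xi> ` {1..<p} \<subseteq> {x. poly E x = 0}" using roots by auto
    then have "card (\<xi> ` {1..<p}) \<le> card {x. poly E x = 0}"
      using poly_roots_finite[OF \<open>E \<noteq> 0\<close>] card_mono by blast
    also have "\<dots> \<le> p - 2" using card_poly_roots_bound[OF \<open>E \<noteq> 0\<close>] degE by linarith
    also have "card (\<xi> ` {1..<p}) = p - 1"
      by (subst card_image) (auto intro!: inj_on_subset[OF gauss_lobatto_inj[OF gl]])
    finally show False using p2 by linarith
  qed
  then have eq: "N \<xi> = N \<xi>'" by (simp add: E_def)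
  have rootN: "{z. poly (w * N x) z = 0} = x ` {..p}" if "gauss_lobatto p x v" for x v
  proof
    show "x ` {..p} \<subseteq> {z. poly (w * N x) z = 0}" using wN0[OF that] by auto
    show "{z. poly (w * N x) z = 0} \<subseteq> x ` {..p}"
    proof
      fix z assume "z \<in> {z. poly (w * N x) z = 0}"
      then have "z\<^sup>2 = 1 \<or> poly (N x) z = 0"
        by (auto simp: w_def power2_eq_square algebra_simps)
      then consider "z = 1" | "z = -1" | "poly (N x) z = 0" by (auto simp: power2_eq_1_iff)
      then show "z \<in> x ` {..p}"
      proof cases
        case 1
        then have "z = x p" using that by (simp add: gauss_lobatto_def)
        then show ?thesis by blast
      next
        case 2
        then have "z = x 0" using that by (simp add: gauss_lobatto_def)
        then show ?thesis by blast
      next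
        case 3
        then show ?thesis by (auto simp: N_def poly_prod)
      qed
    qed
  qed
  have img: "\<xi> ` {..p} = \<xi>' ` {..p}" using rootN[OF gl] rootN[OF gl'] eq by simp
  \<comment> \<open>The node sets agree; increasing enumerations of the same set are equal.\<close>
  have "map \<xi> [0..<Suc p] = map \<xi>' [0..<Suc p]"
  proof (rule strict_sorted_equal)
    have *: "sorted_wrt (<) (map x [0..<Suc p])" if "gauss_lobatto p x v" for x v
      using that unfolding gauss_lobatto_def monotone_on_def sorted_wrt_iff_nth_less
      by (auto simp: nth_map_upt simp del: upt_Suc)
    show "sorted_wrt (<) (map \<xi> [0..<Suc p])" "sorted_wrt (<) (map \<xi>' [0..<Suc p])"
      using *[OF gl] *[OF gl'] .
    show "list.set (map \<xi> [0..<Suc p]) = list.set (map \<xi>' [0..<Suc p])"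
      using img by (simp add: atLeast0LessThan lessThan_Suc_atMost del: upt_Suc)
  qed
  then show ?thesis using k by (auto simp: map_eq_conv simp del: upt_Suc)
qed

section \<open>Nodal Lagrange polynomials and discrete integration by parts\<close>

lemma lagrange_gln:
  assumes "gauss_lobatto (ord T) (gln T) (glw T)" "k \<le> ord T" "l \<le> ord T"
  shows "poly (lagrange T k) (gln T l) = of_bool (k = l)"
proof (cases "k = l")
  case True
  have "poly (smult (1 / (gln T k - gln T i)) [:- gln T i, 1:]) (gln T k) = 1"
    if "i \<in> {..ord T} - {k}" for i
  proof -
    have "gln T k \<noteq> gln T i"
      using gauss_lobatto_inj[OF assms(1)] assms that by (auto simp: inj_on_def)
    then show ?thesis by (simp add: divide_simps)
  qed
  then have "poly (lagrange T k) (gln T k) = 1"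
    unfolding lagrange_def poly_prod by (intro prod.neutral) blast
  then show ?thesis using True by simp
next
  case False
  then show ?thesis
    using assms unfolding lagrange_def poly_prod by (auto intro!: prod_zero bexI[of _ l])
qed

lemma degree_lagrange_le: "degree (lagrange T k) \<le> ord T" if "k \<le> ord T"
proof -
  have "degree (lagrange T k) \<le> (\<Sum>l\<in>{..ord T} - {k}. degree (smult (1 / (gln T k - gln T l)) [:- gln T l, 1:]))"
    unfolding lagrange_def by (rule degree_prod_sum_le[unfolded o_def]) simp
  also have "\<dots> \<le> (\<Sum>l\<in>{..ord T} - {k}. 1)"
    by (intro sum_mono order_trans[OF degree_smult_le]) simp
  finally have "degree (lagrange T k) \<le> (\<Sum>l\<in>{..ord T} - {k}. 1)" .
  then show ?thesis using that by simp
qed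

text \<open>The reflected rule has the same nodes by uniqueness. Integrating the Lagrange polynomial
  of node \<open>k\<close> with both rules, which is exact because its degree is at most
  \<open>p\<close>, picks out one weight on each side.\<close>

lemma glw_symmetric:
  fixes T :: dg_space
  assumes gl: "gauss_lobatto (ord T) (gln T) (glw T)" and p: "ord T \<ge> 1" and k: "k \<le> ord T"
  shows "glw T (ord T - k) = glw T k"
proof -
  let ?p = "ord T"
  note gl' = gauss_lobatto_reflect[OF gl]
  have deg: "degree (lagrange T k) \<le> 2 * ?p - 1" using degree_lagrange_le[OF k] p by linarith
  have "(\<Sum>l\<le>?p. glw T l * poly (lagrange T k) (gln T l))
      = (\<Sum>l\<le>?p. glw T (?p - l) * poly (lagrange T k) (- gln T (?p - l)))"
    by (rule has_integral_unique[OF gauss_lobatto_exact[OF gl deg] gauss_lobatto_exact[OF gl' deg]])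
  also have "\<dots> = (\<Sum>l\<le>?p. glw T (?p - l) * poly (lagrange T k) (gln T l))"
    using gauss_lobatto_nodes_unique[OF gl' gl p] by simp
  finally show ?thesis using k by (simp add: lagrange_gln[OF gl k] of_bool_def if_distrib cong: if_cong)
qed

text \<open>The product of two Lagrange polynomials has a derivative of degree at most
  \<open>2 * p - 1\<close>, so quadrature integrates it exactly. The product rule yields the left
  side, and the values at the end points, which are nodes, yield the right side.\<close>

lemma Qmat_summation_by_parts:
  assumes gl: "gauss_lobatto (ord T) (gln T) (glw T)" and k: "k \<le> ord T" and l: "l \<le> ord T"
    and p: "ord T \<ge> 1"
  shows "Qmat T k l + Qmat T l k = of_bool (k = l \<and> k = ord T) - of_bool (k = l \<and> k = 0)"
proof -
  let ?p = "ord T"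
  define P where "P = lagrange T k * lagrange T l"
  have "degree P \<le> ?p + ?p"
    unfolding P_def using degree_mult_le[of "lagrange T k" "lagrange T l"]
      degree_lagrange_le[OF k] degree_lagrange_le[OF l] by linarith
  then have "degree (pderiv P) \<le> 2 * ?p - 1" using degree_pderiv[of P] by linarith
  from gauss_lobatto_exact[OF gl this]
  have "(poly (pderiv P) has_integral (\<Sum>r\<le>?p. glw T r * poly (pderiv P) (gln T r))) {-1..1}" .
  moreover have "(poly (pderiv P) has_integral (poly P 1 - poly P (-1))) {-1..1}"
    by (rule fundamental_theorem_of_calculus)
      (auto simp: has_real_derivative_iff_has_vector_derivative[symmetric] intro: poly_DERIV DERIV_subset)
  ultimately have *: "(\<Sum>r\<le>?p. glw T r * poly (pderiv P) (gln T r)) = poly P 1 - poly P (-1)"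
    using has_integral_unique by blast
  have ends: "gln T ?p = 1" "gln T 0 = -1" using gl by (auto simp: gauss_lobatto_def)
  have "(\<Sum>r\<le>?p. glw T r * poly (pderiv P) (gln T r)) = Qmat T k l + Qmat T l k"
    by (simp add: P_def pderiv_mult lagrange_gln[OF gl] k l ring_distribs sum.distrib
        of_bool_def if_distrib[where f = "\<lambda>x. x * _"] if_distrib[where f = "\<lambda>x. _ * x"]
        Qmat_def Dmat_def cong: if_cong)
  moreover have "poly P 1 - poly P (-1) = of_bool (k = l \<and> k = ?p) - of_bool (k = l \<and> k = 0)"
    using lagrange_gln[OF gl k, of ?p] lagrange_gln[OF gl l, of ?p]
      lagrange_gln[OF gl k, of 0] lagrange_gln[OF gl l, of 0]
    by (auto simp: P_def ends)
  ultimately show ?thesis using * by simp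
qed

text \<open>Of the two copies of \<open>Qmat T i k\<close>, one is kept; summation by parts turns
  the other into \<open>- Qmat T k i\<close> plus endpoint terms, and the indices are then
  exchanged. Only the antisymmetric part of \<open>c\<close> survives in the volume, which makes
  pairwise estimates possible.\<close>

lemma sum_Qmat_split:
  assumes gl: "gauss_lobatto (ord T) (gln T) (glw T)" and p: "ord T \<ge> 1"
  shows "(\<Sum>i\<le>ord T. \<Sum>k\<le>ord T. 2 * Qmat T i k * c i k)
    = (\<Sum>i\<le>ord T. \<Sum>k\<le>ord T. Qmat T i k * (c i k - c k i)) + (c (ord T) (ord T) - c 0 0)"
proof -
  let ?p = "ord T"
  have "(\<Sum>i\<le>?p. \<Sum>k\<le>?p. Qmat T i k * c k i) = (\<Sum>i\<le>?p. \<Sum>k\<le>?p. Qmat T k i * c i k)"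
    by (rule sum.swap)
  moreover have "(\<Sum>i\<le>?p. \<Sum>k\<le>?p. (Qmat T i k + Qmat T k i) * c i k)
      = (\<Sum>i\<le>?p. \<Sum>k\<le>?p. (of_bool (i = k \<and> i = ?p) - of_bool (i = k \<and> i = 0)) * c i k)"
    using Qmat_summation_by_parts[OF gl _ _ p] by simp
  moreover have "\<dots> = (\<Sum>i\<le>?p. (of_bool (i = ?p) - of_bool (i = 0)) * c i i)"
    by (intro sum.cong refl)
      (simp add: of_bool_def left_diff_distrib sum_subtractf if_distrib[where f = "\<lambda>x. x * _"]
        conj_commute if_if_eq_conj[symmetric] cong: if_cong)
  moreover have "\<dots> = c ?p ?p - c 0 0"
    by (simp add: of_bool_def left_diff_distrib sum_subtractf if_distrib[where f = "\<lambda>x. x * _"] cong: if_cong)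
  moreover have "(\<Sum>i\<le>?p. \<Sum>k\<le>?p. 2 * Qmat T i k * c i k)
      = 2 * (\<Sum>i\<le>?p. \<Sum>k\<le>?p. Qmat T i k * c i k)"
    by (simp add: sum_distrib_left mult.assoc)
  ultimately show ?thesis
    by (simp add: ring_distribs right_diff_distrib sum.distrib sum_subtractf)
qed

section \<open>Entropy estimates for the fluxes\<close>

lemma smooth_imp_C1:
  assumes "smooth F"
  shows "F differentiable (at x)" "continuous_on UNIV (\<lambda>x. frechet_derivative F (at x) v)"
proof -
  have "C_k (Suc 0) F" using assms by (simp add: smooth_def)
  then show "F differentiable (at x)" "continuous_on UNIV (\<lambda>x. frechet_derivative F (at x) v)"
    by auto
qed

text \<open>The flux is the diagonal of the smooth flux \<open>hec\<close>.\<close>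

lemma entropy_conservative_flux_imp_C1:
  assumes "entropy_conservative_flux f \<theta> g hec"
  shows "\<And>w. (f has_vector_derivative vector_derivative f (at w)) (at w)"
    and "continuous_on UNIV (\<lambda>w. vector_derivative f (at w))"
proof -
  define F where "F = (\<lambda>(a::real, b::real, n::real^2). hec a b n)"
  have F: "smooth F" and diag: "\<And>u n. F (u, u, n) = f u \<bullet> n"
    using assms by (auto simp: entropy_conservative_flux_def F_def)
  \<comment> \<open>With \<open>n\<close> frozen at a coordinate vector, the diagonal curve has
    tangent \<open>(1, 1, 0)\<close>, and consistency identifies \<open>F\<close> along it with a
    component of \<open>f\<close>.\<close>
  let ?D = "\<lambda>w. \<chi> i. frechet_derivative F (at (w, w, axis i 1)) (1, 1, 0)"
  have D: "((\<lambda>w. f w \<bullet> axis i 1) has_vector_derivative ?D w \<bullet> axis i 1) (at w)" for w and i :: 2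
  proof -
    have "((\<lambda>w::real. (w, w, axis i 1 :: real^2)) has_vector_derivative (1, 1, 0)) (at w)"
      by (intro has_vector_derivative_Pair has_vector_derivative_const has_vector_derivative_id)
    moreover have "(F has_derivative frechet_derivative F (at (w, w, axis i 1))) (at (w, w, axis i 1))"
      using smooth_imp_C1(1)[OF F] by (simp add: frechet_derivative_works[symmetric])
    ultimately have "((\<lambda>w. F (w, w, axis i 1)) has_vector_derivative
        frechet_derivative F (at (w, w, axis i 1)) (1, 1, 0)) (at w)"
      using vector_derivative_diff_chain_within[of "\<lambda>w. (w, w, axis i 1)" "(1, 1, 0)" w UNIV F]
      by (simp add: o_def has_derivative_at_withinI)
    then show ?thesis by (simp add: diag inner_axis)
  qed
  have fD: "(f has_vector_derivative ?D w) (at w)" for w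
    unfolding has_vector_derivative_def has_derivative_componentwise_within[of f]
    using D[unfolded has_vector_derivative_def] by (auto simp: Basis_vec_def)
  show "(f has_vector_derivative vector_derivative f (at w)) (at w)" for w
    unfolding vector_derivative_at[OF fD] by (rule fD)
  show "continuous_on UNIV (\<lambda>w. vector_derivative f (at w))"
    unfolding vector_derivative_at[OF fD]
    by (intro continuous_on_vec_lambda continuous_on_compose2[OF smooth_imp_C1(2)[OF F]])
      (auto intro!: continuous_intros)
qed

lemma twice_differentiable_deriv:
  assumes "twice_differentiable \<eta>"
  shows "(\<eta> has_real_derivative deriv \<eta> w) (at w)"
    and "(deriv \<eta> has_real_derivative deriv (deriv \<eta>) w) (at w)"
  using assms unfolding twice_differentiable_def
  by (auto simp: DERIV_deriv_iff_real_differentiable)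

text \<open>With \<open>q' = \<eta>' f'\<close> the terms \<open>\<eta>' f'\<close> in \<open>(\<eta>' f - q)'\<close> cancel.\<close>

lemma entropy_potential_has_vector_derivative:
  assumes f: "\<And>w. (f has_vector_derivative vector_derivative f (at w)) (at w)"
    and f': "continuous_on UNIV (\<lambda>w. vector_derivative f (at w))"
    and \<eta>: "twice_differentiable \<eta>" and q: "entropy_pair f \<eta> q"
  shows "(entropy_potential f \<eta> q has_vector_derivative deriv (deriv \<eta>) w *\<^sub>R f w) (at w)"
proof -
  let ?F = "\<lambda>w. deriv \<eta> w *\<^sub>R vector_derivative f (at w)"
  have "continuous_on UNIV (deriv \<eta>)"
    using twice_differentiable_deriv(2)[OF \<eta>] DERIV_continuous continuous_at_imp_continuous_on by blast
  then have cont: "continuous_on A ?F" for A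
    using continuous_on_subset[OF continuous_on_scaleR[OF _ f']] by blast
  \<comment> \<open>The base point \<open>w - 1\<close> places \<open>w\<close> in the interior of
    the interval, so that the one-interval derivative becomes a full derivative.\<close>
  have "((\<lambda>x. integral {w - 1..x} ?F) has_vector_derivative ?F w) (at w within {w - 1..w + 1})"
    by (rule integral_has_vector_derivative[OF cont]) auto
  then have "((\<lambda>x. q (w - 1) + integral {w - 1..x} ?F) has_vector_derivative ?F w) (at w within {w - 1..w + 1})"
    using has_vector_derivative_add[OF has_vector_derivative_const] by fastforce
  moreover have "q (w - 1) + integral {w - 1..x} ?F = q x" if "x \<in> {w - 1..w + 1}" for x
  proof -
    have "(?F has_integral (q x - q (w - 1))) {w - 1..x}"
      using q that by (simp add: entropy_pair_def)
    then show ?thesis by (simp add: integral_unique)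
  qed
  ultimately have "(q has_vector_derivative ?F w) (at w within {w - 1..w + 1})"
    by (subst (asm) has_vector_derivative_cong_ev[where g = q])
      (auto simp: eventually_nhds intro!: exI[of _ UNIV])
  then have "(q has_vector_derivative ?F w) (at w)"
    by (simp add: at_within_Icc_at)
  then show ?thesis
    unfolding entropy_potential_def[abs_def]
    by (auto intro!: derivative_eq_intros f twice_differentiable_deriv(2)[OF \<eta>])
qed

text \<open>Entropy conservation makes \<open>hec a b n\<close> the quotient of the increments of
  the \<open>\<theta>\<close>-potential along \<open>n\<close> and of \<open>deriv \<theta>\<close>.
  Their derivatives share the positive factor \<open>\<theta>''\<close>, which cancels and leaves a
  value of \<open>f\<close>.\<close>

lemma entropy_conservative_flux_mean_value:
  fixes a b :: real
  assumes ec: "entropy_conservative_flux f \<theta> g hec" and \<theta>: "twice_differentiable \<theta>"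
    and pair: "entropy_pair f \<theta> g" and pos: "\<And>w. deriv (deriv \<theta>) w > 0"
    and ab: "a \<le> b"
  obtains c where "c \<in> {a..b}" "hec a b n = f c \<bullet> n"
proof (cases "a = b")
  case True
  then show ?thesis using ec that[of a] by (auto simp: entropy_conservative_flux_def)
next
  case False
  with ab have "a < b" by simp
  note f = entropy_conservative_flux_imp_C1[OF ec]
  let ?\<psi> = "\<lambda>w. entropy_potential f \<theta> g w \<bullet> n"
  have \<psi>: "(?\<psi> has_real_derivative deriv (deriv \<theta>) w * (f w \<bullet> n)) (at w)" for w
    using bounded_linear.has_vector_derivative[OF bounded_linear_inner_left
        entropy_potential_has_vector_derivative[OF f \<theta> pair]]
    by (simp add: has_real_derivative_iff_has_vector_derivative)
  note d = twice_differentiable_deriv(2)[OF \<theta>]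
  obtain c where c: "a < c" "c < b"
    "(?\<psi> b - ?\<psi> a) * deriv (deriv \<theta>) c = (deriv \<theta> b - deriv \<theta> a) * (deriv (deriv \<theta>) c * (f c \<bullet> n))"
    using GMVT'[OF \<open>a < b\<close> DERIV_isCont[OF \<psi>] DERIV_isCont[OF d] d \<psi>] by blast
  have "deriv \<theta> a < deriv \<theta> b"
    by (rule DERIV_pos_imp_increasing[OF \<open>a < b\<close>]) (use d pos in blast)
  moreover have "(deriv \<theta> b - deriv \<theta> a) * hec a b n = ?\<psi> b - ?\<psi> a"
    using ec by (simp add: entropy_conservative_flux_def inner_diff_left)
  with c(3) have "deriv (deriv \<theta>) c * ((deriv \<theta> b - deriv \<theta> a) * hec a b n)
      = deriv (deriv \<theta>) c * ((deriv \<theta> b - deriv \<theta> a) * (f c \<bullet> n))"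
    by (simp add: mult_ac)
  with pos[of c] have "(deriv \<theta> b - deriv \<theta> a) * hec a b n = (deriv \<theta> b - deriv \<theta> a) * (f c \<bullet> n)"
    by simp
  ultimately show ?thesis using that[of c] c by auto
qed

text \<open>As \<open>b \<rightarrow> a\<close> the ratio in the definition of \<open>L_u\<close> tends to \<open>1\<close>.\<close>

lemma entropy_ratio_ge_1:
  assumes \<theta>: "twice_differentiable \<theta>" and pos: "\<And>w. deriv (deriv \<theta>) w > 0" and "m < M"
  shows "entropy_ratio \<theta> m M \<ge> 1"
proof -
  let ?r = "\<lambda>b. deriv (deriv \<theta>) m * (m - b) / (deriv \<theta> m - deriv \<theta> b)"
  have "((\<lambda>b. (deriv \<theta> b - deriv \<theta> m) / (b - m)) \<longlongrightarrow> deriv (deriv \<theta>) m) (at_right m)"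
    using twice_differentiable_deriv(2)[OF \<theta>, of m, THEN has_field_derivative_at_within]
    by (simp add: has_field_derivative_iff)
  then have "((\<lambda>b. deriv (deriv \<theta>) m / ((deriv \<theta> b - deriv \<theta> m) / (b - m))) \<longlongrightarrow>
      deriv (deriv \<theta>) m / deriv (deriv \<theta>) m) (at_right m)"
    using pos[of m] by (intro tendsto_intros) auto
  moreover have "deriv (deriv \<theta>) m / ((deriv \<theta> b - deriv \<theta> m) / (b - m)) = ?r b" for b
    by (metis divide_divide_eq_right minus_diff_eq minus_divide_divide mult_minus_right)
  ultimately have "(?r \<longlongrightarrow> 1) (at_right m)"
    using pos[of m] by simp
  then have lim: "((\<lambda>b. ereal (?r b)) \<longlongrightarrow> 1) (at_right m)"
    by (simp add: one_ereal_def)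
  have "\<forall>\<^sub>F b in at_right m. b \<in> {m<..M}"
    using eventually_at_right_real[OF \<open>m < M\<close>] by eventually_elim auto
  then have ev: "\<forall>\<^sub>F b in at_right m. ereal (?r b) \<le> entropy_ratio \<theta> m M"
  proof eventually_elim
    case (elim b)
    show ?case
      unfolding entropy_ratio_def
      by (intro max.coboundedI2 Sup_upper CollectI exI[of _ m] exI[of _ b])
        (use elim \<open>m < M\<close> in simp)
  qed
  show ?thesis
    by (rule tendsto_upperbound[OF lim ev]) simp
qed

lemma flux_lipschitz_bound:
  assumes L: "flux_lipschitz f m M = ereal L" and a: "a \<in> {m..M}" and b: "b \<in> {m..M}"
  shows "\<bar>(f a - f b) \<bullet> n\<bar> \<le> L * \<bar>a - b\<bar> * norm n"
proof (cases "a = b \<or> n = 0")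
  case False
  have "ereal (\<bar>(f a - f b) \<bullet> (n /\<^sub>R norm n)\<bar> / \<bar>a - b\<bar>) \<le> flux_lipschitz f m M"
    unfolding flux_lipschitz_def
    by (intro max.coboundedI2 Sup_upper CollectI exI[of _ a] exI[of _ b] exI[of _ "n /\<^sub>R norm n"])
      (use a b False in simp)
  then have "\<bar>(f a - f b) \<bullet> (n /\<^sub>R norm n)\<bar> / \<bar>a - b\<bar> \<le> L" by (simp add: L)
  then show ?thesis using False by (simp add: abs_mult field_simps)
qed auto

text \<open>This measures how far a flux built for \<open>\<theta>\<close> is from conserving
  \<open>\<eta>\<close>. The bound has the form of the graph viscosity tested with
  \<open>deriv \<eta>\<close>, so viscosity can absorb the defect pair by pair.\<close>

lemma entropy_conservative_defect:
  assumes ec: "entropy_conservative_flux f \<theta> g hec" and \<theta>: "twice_differentiable \<theta>"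
    and pair: "entropy_pair f \<theta> g" and pos: "\<And>w. deriv (deriv \<theta>) w > 0"
    and \<eta>: "twice_differentiable \<eta>" and q: "entropy_pair f \<eta> q"
    and convex: "\<And>w. deriv (deriv \<eta>) w \<ge> 0"
    and L: "flux_lipschitz f m M = ereal L" and a: "a \<in> {m..M}" and b: "b \<in> {m..M}"
  shows "\<bar>(deriv \<eta> a - deriv \<eta> b) * hec a b n
            - (entropy_potential f \<eta> q a - entropy_potential f \<eta> q b) \<bullet> n\<bar>
         \<le> L * norm n * ((deriv \<eta> a - deriv \<eta> b) * (a - b))"
proof -
  note f = entropy_conservative_flux_imp_C1[OF ec]
  let ?\<psi> = "\<lambda>w. entropy_potential f \<eta> q w \<bullet> n"
  have \<psi>: "(?\<psi> has_real_derivative deriv (deriv \<eta>) w * (f w \<bullet> n)) (at w)" for w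
    using bounded_linear.has_vector_derivative[OF bounded_linear_inner_left
        entropy_potential_has_vector_derivative[OF f \<eta> q]]
    by (simp add: has_real_derivative_iff_has_vector_derivative)
  note d = twice_differentiable_deriv(2)[OF \<eta>]
  have L0: "L \<ge> 0"
  proof -
    have "0 \<le> flux_lipschitz f m M" by (simp add: flux_lipschitz_def)
    then show ?thesis by (simp add: L)
  qed
  have *: "\<bar>(deriv \<eta> y - deriv \<eta> x) * hec x y n - (?\<psi> y - ?\<psi> x)\<bar>
      \<le> (deriv \<eta> y - deriv \<eta> x) * (L * norm n * (y - x))"
    if xy: "x \<le> y" "x \<in> {m..M}" "y \<in> {m..M}" for x y
  proof -
    obtain c where c: "c \<in> {x..y}" "hec x y n = f c \<bullet> n"
      using entropy_conservative_flux_mean_value[OF ec \<theta> pair pos xy(1)] by blast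
    \<comment> \<open>Uniform in \<open>w\<close>: the mean value point \<open>c\<close> and
      \<open>w\<close> both lie between \<open>x\<close> and \<open>y\<close>.\<close>
    define C where "C = L * norm n * (y - x)"
    have C: "\<bar>hec x y n - f w \<bullet> n\<bar> \<le> C" if w: "w \<in> {x..y}" for w
    proof -
      have "\<bar>hec x y n - f w \<bullet> n\<bar> \<le> L * \<bar>c - w\<bar> * norm n"
        using flux_lipschitz_bound[OF L, of c w n] c xy w by (auto simp: inner_diff_left)
      also have "\<dots> \<le> L * (y - x) * norm n"
        using L0 c w by (intro mult_right_mono mult_left_mono) auto
      finally show ?thesis by (simp add: C_def mult_ac)
    qed
    \<comment> \<open>As \<open>\<eta>''\<close> is not assumed continuous, integration is replaced
      by monotonicity of an antiderivative of
      \<open>\<eta>'' * (C + s * (hec x y n - f w \<bullet> n))\<close>. The signs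
      \<open>s = 1\<close> and \<open>s = -1\<close> give the two halves of the absolute
      value.\<close>
    let ?F = "\<lambda>s w. deriv \<eta> w * (C + s * hec x y n) - s * ?\<psi> w"
    have F: "?F s x \<le> ?F s y" if s: "\<bar>s\<bar> = 1" for s
    proof (rule DERIV_nonneg_imp_nondecreasing[OF xy(1)], goal_cases)
      case (1 w)
      have "(?F s has_real_derivative deriv (deriv \<eta>) w * (C + s * (hec x y n - f w \<bullet> n))) (at w)"
        by (auto intro!: derivative_eq_intros \<psi> d simp: algebra_simps)
      moreover have "\<bar>s * (hec x y n - f w \<bullet> n)\<bar> \<le> C"
        using C[of w] 1 s by (simp add: abs_mult)
      then have "0 \<le> C + s * (hec x y n - f w \<bullet> n)" by linarith
      then have "0 \<le> deriv (deriv \<eta>) w * (C + s * (hec x y n - f w \<bullet> n))" using convex[of w] by simp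
      ultimately show ?case by blast
    qed
    show ?thesis
      using F[of 1] F[of "-1"] unfolding C_def[symmetric] abs_le_iff
      by (simp add: algebra_simps C_def[symmetric])
  qed
  have sym: "hec a b n = hec b a n" using ec by (simp add: entropy_conservative_flux_def)
  show ?thesis
  proof (cases "b \<le> a")
    case True
    then show ?thesis using *[OF True b a] by (simp add: sym inner_diff_left mult_ac)
  next
    case False
    then have "\<bar>(deriv \<eta> b - deriv \<eta> a) * hec a b n - (?\<psi> b - ?\<psi> a)\<bar>
      \<le> (deriv \<eta> b - deriv \<eta> a) * (L * norm n * (b - a))"
      using *[of a b] a b by auto
    moreover have "(deriv \<eta> b - deriv \<eta> a) * hec a b n - (?\<psi> b - ?\<psi> a)
        = - ((deriv \<eta> a - deriv \<eta> b) * hec a b n - (?\<psi> a - ?\<psi> b))"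
      "(deriv \<eta> b - deriv \<eta> a) * (L * norm n * (b - a)) = L * norm n * ((deriv \<eta> a - deriv \<eta> b) * (a - b))"
      by (simp_all add: algebra_simps)
    ultimately show ?thesis by (simp only: abs_minus_cancel inner_diff_left)
  qed
qed

lemma convex_above_tangent:
  assumes "convex_on UNIV \<eta>" "twice_differentiable \<eta>"
  shows "\<eta> y - \<eta> x \<ge> deriv \<eta> x * (y - x)"
  by (rule convex_on_imp_above_tangent[where A = UNIV]) (use assms twice_differentiable_deriv(1) in auto)

text \<open>The three-point inequality with \<open>u\<^sup>- = u\<close>, linearised by convexity of \<open>\<eta>\<close>.\<close>

lemma interface_entropy_inequality:
  assumes h: "interface_flux f m M h" and bp: "bound_preserving_entropy_stable f m M h Q"
    and \<eta>: "twice_differentiable \<eta>" and q: "entropy_pair f \<eta> q"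
    and u: "u \<in> {m..M}" and v: "v \<in> {m..M}" and n: "norm n = 1"
  shows "deriv \<eta> u * (h u v n - f u \<bullet> n) \<ge> Q \<eta> q u v n - q u \<bullet> n"
proof -
  obtain L1 L2 where "ereal (L1 + L2) \<ge> flux_lipschitz f m M"
    using h by (auto simp: interface_flux_def)
  then have \<alpha>: "ereal (max 1 (L1 + L2)) \<ge> flux_lipschitz f m M"
    by (rule order_trans) simp
  \<comment> \<open>The factor \<open>1 / (2 * \<alpha>)\<close> cancels at the end, so any
    admissible value serves: \<open>L1 + L2\<close> dominates the Lipschitz constant of the flux,
    and the 1 ensures positivity.\<close>
  define \<alpha> where "\<alpha> = max 1 (L1 + L2)"
  have pos: "\<alpha> > 0" by (simp add: \<alpha>_def)
  have "\<eta> (three_point_update h \<alpha> n u u v) \<le> \<eta> u - (Q \<eta> q u v n - Q \<eta> q u u n) / (2 * \<alpha>)"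
    using bp \<alpha> u v n q pos unfolding bound_preserving_entropy_stable_def \<alpha>_def[symmetric]
    by (auto simp: dist_norm)
  moreover have "Q \<eta> q u u n = q u \<bullet> n"
    using bp q u n by (simp add: bound_preserving_entropy_stable_def consistent_flux_def)
  moreover have "h u u n = f u \<bullet> n"
    using h u n by (simp add: interface_flux_def consistent_flux_def)
  moreover have "\<eta> (three_point_update h \<alpha> n u u v) - \<eta> u
      \<ge> deriv \<eta> u * (three_point_update h \<alpha> n u u v - u)"
    using q by (intro convex_above_tangent \<eta>) (simp add: entropy_pair_def)
  ultimately have "(Q \<eta> q u v n - q u \<bullet> n) / (2 * \<alpha>) \<le> deriv \<eta> u * (h u v n - f u \<bullet> n) / (2 * \<alpha>)"
    by (simp add: three_point_update_def)
  then show ?thesis using pos by (simp add: divide_le_cancel)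
qed

section \<open>Entropy balance along a line of nodes\<close>

lemma Dmat_le_max_D_ratio:
  assumes gl: "gauss_lobatto (ord T) (gln T) (glw T)" and "i \<le> ord T" "k \<le> ord T" "i \<noteq> k"
  shows "\<bar>Dmat T i k\<bar> \<le> glw T k * max_D_ratio T"
proof -
  let ?S = "{\<bar>Dmat T k l\<bar> / glw T l | k l. k \<le> ord T \<and> l \<le> ord T \<and> k \<noteq> l}"
  have "?S \<subseteq> (\<lambda>(k, l). \<bar>Dmat T k l\<bar> / glw T l) ` ({..ord T} \<times> {..ord T})" by auto
  then have "finite ?S" by (rule finite_subset) simp
  moreover have "\<bar>Dmat T i k\<bar> / glw T k \<in> ?S" using assms by blast
  ultimately have "\<bar>Dmat T i k\<bar> / glw T k \<le> max_D_ratio T"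
    unfolding max_D_ratio_def by (rule Max_ge)
  then show ?thesis using gauss_lobatto_pos[OF gl \<open>k \<le> ord T\<close>] by (simp add: field_simps)
qed

lemma max_D_ratio_nonneg:
  assumes gl: "gauss_lobatto (ord T) (gln T) (glw T)" and p: "ord T \<ge> 1"
  shows "max_D_ratio T \<ge> 0"
proof -
  have "0 \<le> glw T 1 * max_D_ratio T"
    using Dmat_le_max_D_ratio[OF gl, of 0 1] p by linarith
  then show ?thesis using gauss_lobatto_pos[OF gl, of 1] p by (simp add: zero_le_mult_iff)
qed

text \<open>When \<open>m \<ge> M\<close> the supremum \<open>L_u\<close> is taken over the empty set, but then \<open>L_f = 0\<close> as well.\<close>

lemma viscosity_lower_bound:
  assumes \<theta>: "twice_differentiable \<theta>" and pos: "\<And>w. deriv (deriv \<theta>) w > 0"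
    and L: "flux_lipschitz f m M = ereal L" and R: "R \<ge> 0"
    and d: "ereal d \<ge> 4 * flux_lipschitz f m M * entropy_ratio \<theta> m M * ereal R"
  shows "d \<ge> 4 * L * R"
proof (cases "m < M")
  case True
  have L0: "0 \<le> ereal L" unfolding L[symmetric] by (simp add: flux_lipschitz_def)
  have "ereal (4 * L * R) = (4 * ereal L * 1) * ereal R" by simp
  also have "\<dots> \<le> (4 * ereal L * entropy_ratio \<theta> m M) * ereal R"
    by (intro ereal_mult_right_mono ereal_mult_left_mono entropy_ratio_ge_1 \<theta> pos True)
      (use L0 R in auto)
  also have "\<dots> \<le> ereal d" using d by (simp add: L)
  finally show ?thesis by simp
next
  case False
  then have "{ereal (\<bar>(f a - f b) \<bullet> n\<bar> / \<bar>a - b\<bar>) | a b n.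
      a \<in> {m..M} \<and> b \<in> {m..M} \<and> a \<noteq> b \<and> norm n = 1} = {}"
    by auto
  then have "flux_lipschitz f m M = 0" unfolding flux_lipschitz_def by (simp only:) (simp add: bot_ereal_def)
  then have "L = 0" "ereal d \<ge> 0" using L d by (simp_all add: zero_ereal_def[symmetric])
  then show ?thesis by simp
qed

lemma deriv_mono_product_nonneg:
  assumes "twice_differentiable \<eta>" "\<And>w. deriv (deriv \<eta>) w \<ge> 0"
  shows "(deriv \<eta> a - deriv \<eta> b) * (a - b) \<ge> 0"
proof -
  have *: "deriv \<eta> x \<le> deriv \<eta> y" if "x \<le> y" for x y
    using that by (rule DERIV_nonneg_imp_nondecreasing)
      (use twice_differentiable_deriv(2)[OF assms(1)] assms(2) in blast)
  show ?thesis using *[of a b] *[of b a] by (cases "a \<le> b") (auto simp: zero_le_mult_iff)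
qed

text \<open>Averaging the sum with its copy under exchange of indices gives the bilinear form of a
  graph Laplacian, nonnegative term by term once \<open>a\<close> is a monotone function of
  \<open>u\<close>.\<close>

lemma symmetric_dissipation_sum:
  fixes s :: "nat \<Rightarrow> nat \<Rightarrow> real"
  assumes "\<And>i k. i \<le> p \<Longrightarrow> k \<le> p \<Longrightarrow> s i k = s k i"
  shows "(\<Sum>i\<le>p. \<Sum>k\<le>p. s i k * (a i * (u i - u k)))
    = (\<Sum>i\<le>p. \<Sum>k\<le>p. s i k / 2 * ((a i - a k) * (u i - u k)))"
proof -
  have "(\<Sum>i\<le>p. \<Sum>k\<le>p. s i k / 2 * (a k * (u k - u i)))
      = (\<Sum>i\<le>p. \<Sum>k\<le>p. s k i / 2 * (a i * (u i - u k)))"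
    by (rule sum.swap)
  also have "\<dots> = (\<Sum>i\<le>p. \<Sum>k\<le>p. s i k / 2 * (a i * (u i - u k)))"
    using assms by (intro sum.cong refl) simp
  finally have swap: "(\<Sum>i\<le>p. \<Sum>k\<le>p. s i k / 2 * (a k * (u k - u i)))
      = (\<Sum>i\<le>p. \<Sum>k\<le>p. s i k / 2 * (a i * (u i - u k)))" .
  have "(\<Sum>i\<le>p. \<Sum>k\<le>p. s i k * (a i * (u i - u k)))
      = (\<Sum>i\<le>p. \<Sum>k\<le>p. s i k / 2 * (a i * (u i - u k))) + (\<Sum>i\<le>p. \<Sum>k\<le>p. s i k / 2 * (a k * (u k - u i)))"
    unfolding swap unfolding sum.distrib[symmetric] by (intro sum.cong refl) simp
  also have "\<dots> = (\<Sum>i\<le>p. \<Sum>k\<le>p. s i k / 2 * ((a i - a k) * (u i - u k)))"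
    unfolding sum.distrib[symmetric] by (intro sum.cong refl) (simp add: field_simps)
  finally show ?thesis .
qed

text \<open>Stated for abstract \<open>u\<close> and symmetric \<open>n\<close> so that it serves
  both reference directions. The potential term is what the metric identities later remove when the
  lines are combined.\<close>

lemma line_entropy_estimate:
  assumes gl: "gauss_lobatto (ord T) (gln T) (glw T)" and p: "ord T \<ge> 1"
    and ec: "entropy_conservative_flux f \<theta> g hec" and \<theta>: "twice_differentiable \<theta>"
    and pair: "entropy_pair f \<theta> g" and pos: "\<And>w. deriv (deriv \<theta>) w > 0"
    and \<eta>: "twice_differentiable \<eta>" and q: "entropy_pair f \<eta> q"
    and convex: "\<And>w. deriv (deriv \<eta>) w \<ge> 0"
    and L: "flux_lipschitz f m M = ereal L" and d: "d \<ge> 4 * L * max_D_ratio T"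
    and u: "\<And>i. i \<le> ord T \<Longrightarrow> u i \<in> {m..M}"
    and n: "\<And>i k. n i k = n k i"
  shows "q (u (ord T)) \<bullet> n (ord T) (ord T) - q (u 0) \<bullet> n 0 0 \<le>
    (\<Sum>i\<le>ord T.
      (\<Sum>k\<le>ord T. 2 * Qmat T i k *
         (deriv \<eta> (u i) * hec (u i) (u k) (n i k) - entropy_potential f \<eta> q (u i) \<bullet> n i k))
      + d * glw T i * deriv \<eta> (u i) * (\<Sum>k\<le>ord T. glw T k / 2 * norm (n i k) * (u i - u k)))"
proof -
  let ?p = "ord T"
  define c where "c i k = deriv \<eta> (u i) * hec (u i) (u k) (n i k) - entropy_potential f \<eta> q (u i) \<bullet> n i k" for i k
  define s where "s i k = d * glw T i * glw T k / 2 * norm (n i k)" for i k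
  define X where "X i k = (deriv \<eta> (u i) - deriv \<eta> (u k)) * (u i - u k)" for i k
  \<comment> \<open>Consistency of \<open>hec\<close> and the definition of the potential leave the
    entropy flux, which produces the endpoint terms.\<close>
  have diag: "c i i = q (u i) \<bullet> n i i" for i
    using ec by (simp add: c_def entropy_conservative_flux_def entropy_potential_def inner_diff_left)
  \<comment> \<open>The defect of each pair is dominated by the dissipation of the same pair; for
    \<open>i = k\<close> both vanish.\<close>
  have local_ineq: "0 \<le> Qmat T i k * (c i k - c k i) + s i k / 2 * X i k" if i: "i \<le> ?p" and k: "k \<le> ?p" for i k
  proof (cases "i = k")
    case False
    note \<omega> = gauss_lobatto_pos[OF gl i] gauss_lobatto_pos[OF gl k]
    have X: "0 \<le> X i k" unfolding X_def by (rule deriv_mono_product_nonneg[OF \<eta> convex])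
    have "c i k - c k i = (deriv \<eta> (u i) - deriv \<eta> (u k)) * hec (u i) (u k) (n i k)
        - (entropy_potential f \<eta> q (u i) - entropy_potential f \<eta> q (u k)) \<bullet> n i k"
      using ec n[of k i] by (simp add: c_def entropy_conservative_flux_def algebra_simps inner_diff_left)
    then have c: "\<bar>c i k - c k i\<bar> \<le> L * norm (n i k) * X i k"
      using entropy_conservative_defect[OF ec \<theta> pair pos \<eta> q convex L u[OF i] u[OF k]]
      by (simp add: X_def)
    have "\<bar>Qmat T i k\<bar> \<le> glw T i * (glw T k * max_D_ratio T)"
      using Dmat_le_max_D_ratio[OF gl i k False] \<omega> by (simp add: Qmat_def abs_mult)
    then have "\<bar>Qmat T i k * (c i k - c k i)\<bar>
        \<le> glw T i * (glw T k * max_D_ratio T) * (L * norm (n i k) * X i k)"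
      using c unfolding abs_mult by (intro mult_mono) (use max_D_ratio_nonneg[OF gl p] \<omega> in auto)
    also have "\<dots> = (L * max_D_ratio T) * (glw T i * glw T k * norm (n i k) * X i k)" by simp
    \<comment> \<open>The quarter is the 1/2 inside \<open>s\<close> times the 1/2 from
      symmetrisation.\<close>
    also have "\<dots> \<le> (d / 4) * (glw T i * glw T k * norm (n i k) * X i k)"
      using d \<omega> X by (intro mult_right_mono) auto
    also have "\<dots> = s i k / 2 * X i k" by (simp add: s_def)
    finally show ?thesis by linarith
  qed (simp add: X_def)
  have "(\<Sum>i\<le>?p. (\<Sum>k\<le>?p. 2 * Qmat T i k * c i k)
        + d * glw T i * deriv \<eta> (u i) * (\<Sum>k\<le>?p. glw T k / 2 * norm (n i k) * (u i - u k)))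
      = (\<Sum>i\<le>?p. \<Sum>k\<le>?p. 2 * Qmat T i k * c i k)
        + (\<Sum>i\<le>?p. \<Sum>k\<le>?p. s i k * (deriv \<eta> (u i) * (u i - u k)))"
    by (simp add: sum.distrib s_def sum_distrib_left mult_ac)
  also have "(\<Sum>i\<le>?p. \<Sum>k\<le>?p. s i k * (deriv \<eta> (u i) * (u i - u k)))
      = (\<Sum>i\<le>?p. \<Sum>k\<le>?p. s i k / 2 * X i k)"
    unfolding X_def by (rule symmetric_dissipation_sum) (simp add: s_def n[of _ k for k])
  also have "(\<Sum>i\<le>?p. \<Sum>k\<le>?p. 2 * Qmat T i k * c i k) + (\<Sum>i\<le>?p. \<Sum>k\<le>?p. s i k / 2 * X i k)
      = (\<Sum>i\<le>?p. \<Sum>k\<le>?p. Qmat T i k * (c i k - c k i) + s i k / 2 * X i k) + (c ?p ?p - c 0 0)"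
    unfolding sum_Qmat_split[OF gl p] by (simp only: sum.distrib)
  finally have "(\<Sum>i\<le>?p. (\<Sum>k\<le>?p. 2 * Qmat T i k * c i k)
        + d * glw T i * deriv \<eta> (u i) * (\<Sum>k\<le>?p. glw T k / 2 * norm (n i k) * (u i - u k)))
      = (\<Sum>i\<le>?p. \<Sum>k\<le>?p. Qmat T i k * (c i k - c k i) + s i k / 2 * X i k) + (c ?p ?p - c 0 0)" .
  moreover have "0 \<le> (\<Sum>i\<le>?p. \<Sum>k\<le>?p. Qmat T i k * (c i k - c k i) + s i k / 2 * X i k)"
    using local_ineq by (intro sum_nonneg) auto
  ultimately show ?thesis unfolding diag c_def[symmetric] by linarith
qed

section \<open>Element and edge nodes\<close>

locale gauss_lobatto_mesh =
  fixes T :: dg_space and \<Omega> :: "(real^2) set"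
  assumes ord_ge_1: "ord T \<ge> 1"
    and nodes: "gauss_lobatto (ord T) (gln T) (glw T)"
    and mesh: "dg_mesh T \<Omega>"
begin

lemma reference_node: "k \<le> ord T \<Longrightarrow> l \<le> ord T \<Longrightarrow> vector [gln T k, gln T l] \<in> ref_square"
  using gauss_lobatto_nodes_bounded[OF nodes] by (simp add: ref_square_def forall_2)

lemma geo_map_reference_node:
  assumes "k \<le> ord T" "l \<le> ord T"
  shows "geo_map T \<kappa> (vector [gln T k, gln T l]) = node T \<kappa> k l"
proof -
  have "geo_map T \<kappa> (vector [gln T k, gln T l]) =
      (\<Sum>i\<le>ord T. \<Sum>j\<le>ord T. if i = k then if j = l then node T \<kappa> i j else 0 else 0)"
    unfolding geo_map_def
    by (intro sum.cong refl) (simp add: lagrange_gln[OF nodes] assms)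
  also have "\<dots> = (\<Sum>i\<le>ord T. if i = k then (\<Sum>j\<le>ord T. if j = l then node T \<kappa> i j else 0) else 0)"
    by (intro sum.cong refl) simp
  finally show ?thesis using assms by simp
qed

lemma geo_map_inj: "\<kappa> \<in> elements T \<Longrightarrow> inj_on (geo_map T \<kappa>) ref_square"
  using mesh by (simp add: dg_mesh_def valid_elements_def)

lemma basis_fun_node:
  assumes "\<kappa> \<in> elements T" "i \<le> ord T" "j \<le> ord T" "k \<le> ord T" "l \<le> ord T"
  shows "basis_fun T \<kappa> i j (node T \<kappa> k l) = of_bool (i = k) * of_bool (j = l)"
proof -
  have "inv_into ref_square (geo_map T \<kappa>) (node T \<kappa> k l) = vector [gln T k, gln T l]"
    unfolding geo_map_reference_node[OF assms(4,5), symmetric]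
    by (rule inv_into_f_f[OF geo_map_inj reference_node]) (use assms in auto)
  then show ?thesis by (simp add: basis_fun_def lagrange_gln[OF nodes] assms)
qed

lemma sum_basis_fun_node:
  fixes G :: "nat \<Rightarrow> nat \<Rightarrow> real"
  assumes "\<kappa> \<in> elements T" "k \<le> ord T" "l \<le> ord T"
  shows "(\<Sum>i\<le>ord T. \<Sum>j\<le>ord T. basis_fun T \<kappa> i j (node T \<kappa> k l) * G i j) = G k l"
proof -
  have "(\<Sum>i\<le>ord T. \<Sum>j\<le>ord T. basis_fun T \<kappa> i j (node T \<kappa> k l) * G i j)
      = (\<Sum>i\<le>ord T. if i = k then (\<Sum>j\<le>ord T. if j = l then G i j else 0) else 0)"
    by (intro sum.cong refl) (simp add: basis_fun_node assms of_bool_def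
        if_distrib[where f = "\<lambda>x. x * _"] cong: if_cong)
  then show ?thesis using assms by simp
qed

lemma discrete_fun_node:
  "\<kappa> \<in> elements T \<Longrightarrow> k \<le> ord T \<Longrightarrow> l \<le> ord T \<Longrightarrow> discrete_fun T U \<kappa> (node T \<kappa> k l) = U \<kappa> k l"
  unfolding discrete_fun_def by (rule sum_basis_fun_node)

text \<open>An edge may run through the nodes of an element backwards; the weights agree because
  Gauss--Lobatto rules are symmetric.\<close>

lemma nodes_match_reindex:
  assumes "nodes_match T e x"
  obtains \<sigma> where "bij_betw \<sigma> {..ord T} {..ord T}"
    "\<And>k. k \<le> ord T \<Longrightarrow> glw T (\<sigma> k) = glw T k"
    "\<And>k. k \<le> ord T \<Longrightarrow> edge_node T e (\<sigma> k) = x k"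
proof -
  consider "\<forall>k\<le>ord T. edge_node T e k = x k" | "\<forall>k\<le>ord T. edge_node T e k = x (ord T - k)"
    using assms by (auto simp: nodes_match_def)
  then show thesis
  proof cases
    case 1
    then show ?thesis using that[of id] by simp
  next
    case 2
    have "bij_betw (\<lambda>k. ord T - k) {..ord T} {..ord T}"
      by (rule bij_betw_byWitness[where f' = "\<lambda>k. ord T - k"]) auto
    then show ?thesis
      using that[of "\<lambda>k. ord T - k"] 2 glw_symmetric[OF nodes ord_ge_1] by simp
  qed
qed

section \<open>Sides of an element and quadrature over its boundary\<close>

lemma nodes_match_edges:
  assumes "\<kappa> \<in> elements T"
  shows "nodes_match T (side T \<kappa> 1 (-1)) (\<lambda>j. node T \<kappa> 0 j)"
    and "nodes_match T (side T \<kappa> 1 1) (\<lambda>j. node T \<kappa> (ord T) j)"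
    and "nodes_match T (side T \<kappa> 2 (-1)) (\<lambda>i. node T \<kappa> i 0)"
    and "nodes_match T (side T \<kappa> 2 1) (\<lambda>i. node T \<kappa> i (ord T))"
  using mesh assms by (auto simp: dg_mesh_def watertight_def)

lemma edge_node_is_node:
  assumes \<kappa>: "\<kappa> \<in> elements T" and e: "e \<in> edges T \<kappa>" and k: "k \<le> ord T"
  obtains i j where "i \<le> ord T" "j \<le> ord T" "edge_node T e k = node T \<kappa> i j"
proof -
  have *: "\<exists>l\<le>ord T. edge_node T e k = x l" if "nodes_match T e x" for e x
    using that k unfolding nodes_match_def by (metis diff_le_self)
  from e consider "e = side T \<kappa> 1 (-1)" | "e = side T \<kappa> 1 1" | "e = side T \<kappa> 2 (-1)" | "e = side T \<kappa> 2 1"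
    by (auto simp: edges_def)
  then show thesis
    by cases (use nodes_match_edges[OF \<kappa>, THEN *] that in blast)+
qed

text \<open>Since \<open>edges\<close> is a set, a sum over it has four terms only if the sides are
  distinct. Injectivity of the element map moves the question to the reference square.\<close>

lemma side_eq_iff:
  assumes "\<kappa> \<in> elements T" "s \<in> {-1, 1}" "s' \<in> {-1, 1}"
  shows "side T \<kappa> c s = side T \<kappa> c' s' \<longleftrightarrow> c = c' \<and> s = s'"
proof
  assume "side T \<kappa> c s = side T \<kappa> c' s'"
  then have eq: "{z \<in> ref_square. z $ c = s} = {z \<in> ref_square. z $ c' = s'}"
    unfolding side_def by (subst (asm) inj_on_image_eq_iff[OF geo_map_inj[OF assms(1)]]) auto
  \<comment> \<open>This point lies on the first side; when \<open>c'\<close> differs from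
    \<open>c\<close> its coordinate \<open>c'\<close> is \<open>- s'\<close>, which keeps it off the
    second side.\<close>
  have "(\<chi> i. if i = c then s else - s') \<in> {z \<in> ref_square. z $ c = s}"
    using assms by (auto simp: ref_square_def)
  then have "(if c' = c then s else - s') = s'" unfolding eq by simp
  then show "c = c' \<and> s = s'" using assms(3) by (auto split: if_splits)
qed simp

lemma sum_edges:
  assumes "\<kappa> \<in> elements T"
  shows "sum F (edges T \<kappa>) = F (side T \<kappa> 1 (-1)) + F (side T \<kappa> 1 1) + F (side T \<kappa> 2 (-1)) + F (side T \<kappa> 2 1)"
  unfolding edges_def by (simp add: side_eq_iff[OF assms] add.assoc)

text \<open>One argument for all four sides: \<open>a\<close> and \<open>b\<close> index the element
  nodes along the side, \<open>\<mu>\<close> is the outward metric vector with its sign included,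
  and the orientation of the edge is hidden in the permutation.\<close>

lemma face_quadrature:
  fixes q :: "real \<Rightarrow> real^2"
  assumes \<kappa>: "\<kappa> \<in> elements T"
    and match: "nodes_match T e (\<lambda>j. node T \<kappa> (a j) (b j))"
    and ab: "\<And>j. j \<le> ord T \<Longrightarrow> a j \<le> ord T \<and> b j \<le> ord T"
    and \<mu>: "\<And>j k. j \<le> ord T \<Longrightarrow> k \<le> ord T \<Longrightarrow> edge_node T e k = node T \<kappa> (a j) (b j) \<Longrightarrow>
              \<mu> j = Jedge T e k *\<^sub>R normal T \<kappa> e k"
  shows "(\<Sum>k\<le>ord T. glw T k * Jedge T e k * (q (inner_trace T U \<kappa> e k) \<bullet> normal T \<kappa> e k))
    = (\<Sum>j\<le>ord T. glw T j * (q (U \<kappa> (a j) (b j)) \<bullet> \<mu> j))"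
proof -
  obtain \<sigma> where \<sigma>: "bij_betw \<sigma> {..ord T} {..ord T}"
    "\<And>k. k \<le> ord T \<Longrightarrow> glw T (\<sigma> k) = glw T k"
    "\<And>k. k \<le> ord T \<Longrightarrow> edge_node T e (\<sigma> k) = node T \<kappa> (a k) (b k)"
    using nodes_match_reindex[OF match] by metis
  have \<sigma>_le: "\<sigma> j \<le> ord T" if "j \<le> ord T" for j
    using bij_betwE[OF \<sigma>(1)] that by auto
  have "(\<Sum>k\<le>ord T. glw T k * Jedge T e k * (q (inner_trace T U \<kappa> e k) \<bullet> normal T \<kappa> e k))
      = (\<Sum>j\<le>ord T. glw T (\<sigma> j) * Jedge T e (\<sigma> j) * (q (inner_trace T U \<kappa> e (\<sigma> j)) \<bullet> normal T \<kappa> e (\<sigma> j)))"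
    by (rule sum.reindex_bij_betw[OF \<sigma>(1), symmetric])
  also have "\<dots> = (\<Sum>j\<le>ord T. glw T j * (q (U \<kappa> (a j) (b j)) \<bullet> \<mu> j))"
  proof (intro sum.cong refl)
    fix j assume "j \<in> {..ord T}"
    then have j: "j \<le> ord T" by simp
    have "inner_trace T U \<kappa> e (\<sigma> j) = U \<kappa> (a j) (b j)"
      unfolding inner_trace_def \<sigma>(3)[OF j] by (rule discrete_fun_node) (use \<kappa> ab[OF j] in auto)
    then show "glw T (\<sigma> j) * Jedge T e (\<sigma> j) * (q (inner_trace T U \<kappa> e (\<sigma> j)) \<bullet> normal T \<kappa> e (\<sigma> j))
        = glw T j * (q (U \<kappa> (a j) (b j)) \<bullet> \<mu> j)"
      using \<mu>[OF j \<sigma>_le[OF j] \<sigma>(3)[OF j]] \<sigma>(2)[OF j] by simp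
  qed
  finally show ?thesis .
qed

text \<open>The right side is written so as to coincide with the weighted endpoint terms of
  \<open>line_entropy_estimate\<close> over all lines of nodes.\<close>

lemma boundary_quadrature:
  fixes q :: "real \<Rightarrow> real^2"
  assumes \<kappa>: "\<kappa> \<in> elements T"
  shows "(\<Sum>e\<in>edges T \<kappa>. \<Sum>k\<le>ord T. glw T k * Jedge T e k * (q (inner_trace T U \<kappa> e k) \<bullet> normal T \<kappa> e k))
    = (\<Sum>j\<le>ord T. glw T j * (q (U \<kappa> (ord T) j) \<bullet> metric_xi T \<kappa> (ord T) (ord T) j
                               - q (U \<kappa> 0 j) \<bullet> metric_xi T \<kappa> 0 0 j))
    + (\<Sum>i\<le>ord T. glw T i * (q (U \<kappa> i (ord T)) \<bullet> metric_zeta T \<kappa> i (ord T) (ord T)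
                               - q (U \<kappa> i 0) \<bullet> metric_zeta T \<kappa> i 0 0))"
proof -
  note match = nodes_match_edges[OF \<kappa>]
  have c: "face_metric_compatible T" using mesh by (simp add: dg_mesh_def)
  note c = c[unfolded face_metric_compatible_def Let_def, rule_format, OF \<kappa>]
  show ?thesis
    unfolding sum_edges[OF \<kappa>]
    by (subst face_quadrature[OF \<kappa> match(1), where \<mu> = "\<lambda>j. - metric_xi T \<kappa> 0 0 j"],
        simp, metis c minus_minus,
        subst face_quadrature[OF \<kappa> match(2), where \<mu> = "\<lambda>j. metric_xi T \<kappa> (ord T) (ord T) j"],
        simp, metis c,
        subst face_quadrature[OF \<kappa> match(3), where \<mu> = "\<lambda>i. - metric_zeta T \<kappa> i 0 0"],
        simp, metis c minus_minus,
        subst face_quadrature[OF \<kappa> match(4), where \<mu> = "\<lambda>i. metric_zeta T \<kappa> i (ord T) (ord T)"],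
        simp, metis c)
      (simp add: right_diff_distrib sum_subtractf sum_negf)
qed

lemma inner_trace_in:
  assumes "dofs_in T S U" "\<kappa> \<in> elements T" "e \<in> edges T \<kappa>" "k \<le> ord T"
  shows "inner_trace T U \<kappa> e k \<in> S"
proof -
  obtain i j where ij: "i \<le> ord T" "j \<le> ord T" "edge_node T e k = node T \<kappa> i j"
    using edge_node_is_node assms(2-4) by blast
  then show ?thesis
    using assms by (simp add: inner_trace_def discrete_fun_node dofs_in_def)
qed

lemma outer_trace_in:
  assumes "dofs_in T S U" "\<kappa> \<in> elements T" "e \<in> edges T \<kappa>" "k \<le> ord T"
  shows "outer_trace T U \<kappa> e k \<in> S"
proof -
  have "\<exists>!\<kappa>'. \<kappa>' \<in> elements T \<and> \<kappa>' \<noteq> \<kappa> \<and> e \<in> edges T \<kappa>'"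
    using mesh assms by (auto simp: dg_mesh_def watertight_def)
  then have "neighbour T \<kappa> e \<in> elements T" "e \<in> edges T (neighbour T \<kappa> e)"
    unfolding neighbour_def by (metis (mono_tags, lifting) theI')+
  then show ?thesis
    using inner_trace_in[OF assms(1) _ _ assms(4)] by (simp add: outer_trace_def inner_trace_def)
qed

text \<open>Collocation: at an edge node one basis function equals one and the others vanish, so
  interpolation there commutes with an arbitrary nonlinear \<open>G\<close>.\<close>

lemma sum_basis_fun_edge_node:
  assumes \<kappa>: "\<kappa> \<in> elements T" and "e \<in> edges T \<kappa>" "k \<le> ord T"
  shows "(\<Sum>i\<le>ord T. \<Sum>j\<le>ord T. basis_fun T \<kappa> i j (edge_node T e k) * G (U \<kappa> i j))
    = (G (inner_trace T U \<kappa> e k) :: real)"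
proof -
  obtain i j where ij: "i \<le> ord T" "j \<le> ord T" "edge_node T e k = node T \<kappa> i j"
    using edge_node_is_node assms by blast
  then show ?thesis
    by (simp add: inner_trace_def discrete_fun_node[OF \<kappa>] sum_basis_fun_node[OF \<kappa>])
qed

text \<open>Applied with \<open>v\<close> the potential at node \<open>(i, j)\<close>, which does
  not depend on the summation index.\<close>

lemma metric_identity_weighted:
  assumes \<kappa>: "\<kappa> \<in> elements T" and i: "i \<le> ord T" and j: "j \<le> ord T"
  shows "(\<Sum>k\<le>ord T. (glw T j * Qmat T i k) * (v \<bullet> metric_xi T \<kappa> i k j)
                     + (glw T i * Qmat T j k) * (v \<bullet> metric_zeta T \<kappa> i j k)) = 0"
proof -
  have "(\<Sum>k\<le>ord T. Dmat T i k *\<^sub>R metric_xi T \<kappa> i k j + Dmat T j k *\<^sub>R metric_zeta T \<kappa> i j k) = 0"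
    using mesh \<kappa> i j by (simp add: dg_mesh_def discrete_metric_identities_def)
  then have "(glw T i * glw T j) *
      (v \<bullet> (\<Sum>k\<le>ord T. Dmat T i k *\<^sub>R metric_xi T \<kappa> i k j + Dmat T j k *\<^sub>R metric_zeta T \<kappa> i j k)) = 0"
    by simp
  then show ?thesis
    by (simp add: inner_sum_right inner_add_right sum_distrib_left Qmat_def algebra_simps)
qed

section \<open>Entropy production of one element\<close>

lemma cell_volume_pos:
  assumes "\<kappa> \<in> elements T"
  shows "cell_volume T \<kappa> > 0"
  unfolding cell_volume_def
  using mesh assms gauss_lobatto_pos[OF nodes]
  by (intro sum_pos) (auto simp: dg_mesh_def valid_elements_def)

lemma boundary_residual_sum:
  assumes \<kappa>: "\<kappa> \<in> elements T"
  shows "(\<Sum>i\<le>ord T. \<Sum>j\<le>ord T. a (U \<kappa> i j) * (\<Sum>e\<in>edges T \<kappa>. \<Sum>k\<le>ord T.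
          basis_fun T \<kappa> i j (edge_node T e k) * glw T k * Jedge T e k *
            (h (U \<kappa> i j) (outer_trace T U \<kappa> e k) (normal T \<kappa> e k) - f (U \<kappa> i j) \<bullet> normal T \<kappa> e k)))
    = (\<Sum>e\<in>edges T \<kappa>. \<Sum>k\<le>ord T. glw T k * Jedge T e k * (a (inner_trace T U \<kappa> e k) *
        (h (inner_trace T U \<kappa> e k) (outer_trace T U \<kappa> e k) (normal T \<kappa> e k)
           - f (inner_trace T U \<kappa> e k) \<bullet> normal T \<kappa> e k)))"
proof -
  define G where "G e k v = glw T k * Jedge T e k *
      (a v * (h v (outer_trace T U \<kappa> e k) (normal T \<kappa> e k) - f v \<bullet> normal T \<kappa> e k))" for e k v
  have "(\<Sum>i\<le>ord T. \<Sum>j\<le>ord T. a (U \<kappa> i j) * (\<Sum>e\<in>edges T \<kappa>. \<Sum>k\<le>ord T.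
          basis_fun T \<kappa> i j (edge_node T e k) * glw T k * Jedge T e k *
            (h (U \<kappa> i j) (outer_trace T U \<kappa> e k) (normal T \<kappa> e k) - f (U \<kappa> i j) \<bullet> normal T \<kappa> e k)))
      = (\<Sum>i\<le>ord T. \<Sum>j\<le>ord T. \<Sum>e\<in>edges T \<kappa>. \<Sum>k\<le>ord T.
          basis_fun T \<kappa> i j (edge_node T e k) * G e k (U \<kappa> i j))"
    unfolding sum_distrib_left G_def by (intro sum.cong refl) (simp add: mult_ac)
  also have "\<dots> = (\<Sum>i\<le>ord T. \<Sum>e\<in>edges T \<kappa>. \<Sum>k\<le>ord T. \<Sum>j\<le>ord T.
          basis_fun T \<kappa> i j (edge_node T e k) * G e k (U \<kappa> i j))"
    by (intro sum.cong refl, subst sum.swap) (intro sum.cong refl sum.swap)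
  also have "\<dots> = (\<Sum>e\<in>edges T \<kappa>. \<Sum>k\<le>ord T. \<Sum>i\<le>ord T. \<Sum>j\<le>ord T.
          basis_fun T \<kappa> i j (edge_node T e k) * G e k (U \<kappa> i j))"
    by (subst sum.swap) (intro sum.cong refl sum.swap)
  also have "\<dots> = (\<Sum>e\<in>edges T \<kappa>. \<Sum>k\<le>ord T. G e k (inner_trace T U \<kappa> e k))"
    by (intro sum.cong refl) (simp add: sum_basis_fun_edge_node[OF \<kappa>])
  finally show ?thesis by (simp add: G_def)
qed

text \<open>The lines of nodes supply the fluxes \<open>q\<close> on the boundary from inside, and
  the interface terms supply \<open>Q\<close> minus \<open>q\<close>; the sum leaves
  \<open>Q\<close>.\<close>

lemma cell_entropy_production:
  assumes \<kappa>: "\<kappa> \<in> elements T" and u: "dofs_in T {m..M} U"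
    and ec: "entropy_conservative_flux f \<theta> g hec" and \<theta>: "twice_differentiable \<theta>"
    and pair: "entropy_pair f \<theta> g" and pos: "\<And>w. deriv (deriv \<theta>) w > 0"
    and h: "interface_flux f m M h" and bp: "bound_preserving_entropy_stable f m M h Q"
    and \<eta>: "twice_differentiable \<eta>" and q: "entropy_pair f \<eta> q"
    and convex: "\<And>w. deriv (deriv \<eta>) w \<ge> 0"
    and L: "flux_lipschitz f m M = ereal L" and d: "d \<kappa> \<ge> 4 * L * max_D_ratio T"
  shows "(\<Sum>e\<in>edges T \<kappa>. \<Sum>k\<le>ord T. glw T k * Jedge T e k *
            Q \<eta> q (inner_trace T U \<kappa> e k) (outer_trace T U \<kappa> e k) (normal T \<kappa> e k))
    \<le> (\<Sum>i\<le>ord T. \<Sum>j\<le>ord T. deriv \<eta> (U \<kappa> i j) *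
          (residual T f hec h U \<kappa> i j + graph_viscosity T d U \<kappa> i j))"
proof -
  let ?p = "ord T" and ?\<psi> = "entropy_potential f \<eta> q"
  define a where "a = deriv \<eta>"
  define u where "u = U \<kappa>"
  define X where "X i j = (\<Sum>k\<le>?p. 2 * Qmat T i k *
      (a (u i j) * hec (u i j) (u k j) (metric_xi T \<kappa> i k j) - ?\<psi> (u i j) \<bullet> metric_xi T \<kappa> i k j))
      + d \<kappa> * glw T i * a (u i j) *
          (\<Sum>k\<le>?p. glw T k / 2 * norm (metric_xi T \<kappa> i k j) * (u i j - u k j))" for i j
  define Z where "Z i j = (\<Sum>k\<le>?p. 2 * Qmat T j k *
      (a (u i j) * hec (u i j) (u i k) (metric_zeta T \<kappa> i j k) - ?\<psi> (u i j) \<bullet> metric_zeta T \<kappa> i j k))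
      + d \<kappa> * glw T j * a (u i j) *
          (\<Sum>k\<le>?p. glw T k / 2 * norm (metric_zeta T \<kappa> i j k) * (u i j - u i k))" for i j
  define B where "B i j = (\<Sum>e\<in>edges T \<kappa>. \<Sum>k\<le>ord T.
          basis_fun T \<kappa> i j (edge_node T e k) * glw T k * Jedge T e k *
            (h (u i j) (outer_trace T U \<kappa> e k) (normal T \<kappa> e k)
               - f (u i j) \<bullet> normal T \<kappa> e k))" for i j
  have u_in: "u i j \<in> {m..M}" if "i \<le> ?p" "j \<le> ?p" for i j
    using u \<kappa> that by (simp add: dofs_in_def u_def)
  \<comment> \<open>The potential terms hidden in \<open>X\<close> and \<open>Z\<close> cancel only
    in this combination of both directions, through the metric identities.\<close>
  have split: "a (u i j) * (residual T f hec h U \<kappa> i j + graph_viscosity T d U \<kappa> i j)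
      = glw T j * X i j + glw T i * Z i j + a (u i j) * B i j" if ij: "i \<le> ?p" "j \<le> ?p" for i j
  proof -
    have "glw T j * X i j + glw T i * Z i j =
        a (u i j) * (2 * (glw T j * (\<Sum>k\<le>?p. Qmat T i k * hec (u i j) (u k j) (metric_xi T \<kappa> i k j))
          + glw T i * (\<Sum>k\<le>?p. Qmat T j k * hec (u i j) (u i k) (metric_zeta T \<kappa> i j k))))
        + a (u i j) * graph_viscosity T d U \<kappa> i j
        - 2 * (\<Sum>k\<le>?p. (glw T j * Qmat T i k) * (?\<psi> (u i j) \<bullet> metric_xi T \<kappa> i k j)
                     + (glw T i * Qmat T j k) * (?\<psi> (u i j) \<bullet> metric_zeta T \<kappa> i j k))"
      unfolding X_def Z_def graph_viscosity_def u_def[symmetric]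
      by (simp add: sum_distrib_left sum.distrib sum_subtractf algebra_simps)
    then show ?thesis
      unfolding metric_identity_weighted[OF \<kappa> ij]
      by (simp add: residual_def B_def u_def[symmetric] algebra_simps)
  qed
  have line_xi: "q (u ?p j) \<bullet> metric_xi T \<kappa> ?p ?p j - q (u 0 j) \<bullet> metric_xi T \<kappa> 0 0 j \<le> (\<Sum>i\<le>?p. X i j)"
    if "j \<le> ?p" for j
    unfolding X_def a_def
    by (rule line_entropy_estimate[OF nodes ord_ge_1 ec \<theta> pair pos \<eta> q convex L d])
      (use u_in that in \<open>auto simp: metric_xi_def add.commute\<close>)
  have line_zeta: "q (u i ?p) \<bullet> metric_zeta T \<kappa> i ?p ?p - q (u i 0) \<bullet> metric_zeta T \<kappa> i 0 0 \<le> (\<Sum>j\<le>?p. Z i j)"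
    if "i \<le> ?p" for i
    unfolding Z_def a_def
    by (rule line_entropy_estimate[OF nodes ord_ge_1 ec \<theta> pair pos \<eta> q convex L d])
      (use u_in that in \<open>auto simp: metric_zeta_def add.commute\<close>)
  note \<omega> = gauss_lobatto_pos[OF nodes]
  let ?um = "inner_trace T U \<kappa>" and ?up = "outer_trace T U \<kappa>" and ?n = "normal T \<kappa>"
  have "(\<Sum>e\<in>edges T \<kappa>. \<Sum>k\<le>?p. glw T k * Jedge T e k * Q \<eta> q (?um e k) (?up e k) (?n e k))
      \<le> (\<Sum>e\<in>edges T \<kappa>. \<Sum>k\<le>?p. glw T k * Jedge T e k * (q (?um e k) \<bullet> ?n e k)
          + glw T k * Jedge T e k * (a (?um e k) * (h (?um e k) (?up e k) (?n e k) - f (?um e k) \<bullet> ?n e k)))"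
  proof (intro sum_mono)
    fix e k assume e: "e \<in> edges T \<kappa>" and "k \<in> {..?p}"
    then have k: "k \<le> ?p" by simp
    have n: "norm (?n e k) = 1" using mesh \<kappa> e k by (simp add: dg_mesh_def valid_edges_def)
    have "Q \<eta> q (?um e k) (?up e k) (?n e k)
        \<le> q (?um e k) \<bullet> ?n e k + a (?um e k) * (h (?um e k) (?up e k) (?n e k) - f (?um e k) \<bullet> ?n e k)"
      using interface_entropy_inequality[OF h bp \<eta> q inner_trace_in[OF u \<kappa> e k] outer_trace_in[OF u \<kappa> e k] n]
      by (simp add: a_def)
    moreover have "0 \<le> glw T k * Jedge T e k" using \<omega>[OF k] by (simp add: Jedge_def)
    ultimately show "glw T k * Jedge T e k * Q \<eta> q (?um e k) (?up e k) (?n e k)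
        \<le> glw T k * Jedge T e k * (q (?um e k) \<bullet> ?n e k)
          + glw T k * Jedge T e k * (a (?um e k) * (h (?um e k) (?up e k) (?n e k) - f (?um e k) \<bullet> ?n e k))"
      unfolding distrib_left[symmetric] by (rule mult_left_mono)
  qed
  \<comment> \<open>The \<open>q\<close> part of the face sum becomes the endpoint values of all
    lines of nodes, ready to be bounded by volume terms.\<close>
  also have "\<dots> = (\<Sum>j\<le>?p. glw T j * (q (u ?p j) \<bullet> metric_xi T \<kappa> ?p ?p j - q (u 0 j) \<bullet> metric_xi T \<kappa> 0 0 j))
      + (\<Sum>i\<le>?p. glw T i * (q (u i ?p) \<bullet> metric_zeta T \<kappa> i ?p ?p - q (u i 0) \<bullet> metric_zeta T \<kappa> i 0 0))
      + (\<Sum>i\<le>?p. \<Sum>j\<le>?p. a (u i j) * B i j)"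
    unfolding sum.distrib boundary_quadrature[OF \<kappa>] B_def u_def boundary_residual_sum[OF \<kappa>] ..
  also have "\<dots> \<le> (\<Sum>j\<le>?p. glw T j * (\<Sum>i\<le>?p. X i j)) + (\<Sum>i\<le>?p. glw T i * (\<Sum>j\<le>?p. Z i j))
      + (\<Sum>i\<le>?p. \<Sum>j\<le>?p. a (u i j) * B i j)"
    by (intro add_mono sum_mono mult_left_mono order_refl line_xi line_zeta) (use \<omega> in \<open>auto simp: less_imp_le\<close>)
  also have "(\<Sum>j\<le>?p. glw T j * (\<Sum>i\<le>?p. X i j)) = (\<Sum>i\<le>?p. \<Sum>j\<le>?p. glw T j * X i j)"
    unfolding sum_distrib_left by (rule sum.swap)
  also have "(\<Sum>i\<le>?p. \<Sum>j\<le>?p. glw T j * X i j) + (\<Sum>i\<le>?p. glw T i * (\<Sum>j\<le>?p. Z i j))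
      + (\<Sum>i\<le>?p. \<Sum>j\<le>?p. a (u i j) * B i j)
      = (\<Sum>i\<le>?p. \<Sum>j\<le>?p. a (u i j) * (residual T f hec h U \<kappa> i j + graph_viscosity T d U \<kappa> i j))"
    by (simp add: split sum.distrib sum_distrib_left)
  finally show ?thesis by (simp add: a_def u_def)
qed

end

section \<open>The backward Euler step\<close>

theorem theorem3p4:
  fixes f :: "real \<Rightarrow> real^2"
    and \<Omega> :: "(real^2) set" and u0 :: "real^2 \<Rightarrow> real" and m M :: real
    and T :: dg_space
    and \<theta> :: "real \<Rightarrow> real" and g :: "real \<Rightarrow> real^2"
    and hec h :: "real \<Rightarrow> real \<Rightarrow> real^2 \<Rightarrow> real"
    and Q :: "(real \<Rightarrow> real) \<Rightarrow> (real \<Rightarrow> real^2) \<Rightarrow> real \<Rightarrow> real \<Rightarrow> real^2 \<Rightarrow> real"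
    and d :: "element \<Rightarrow> real"
    and \<Delta>t :: real
    and U U' :: dofs
  assumes "locally_lipschitz f"
    and "essential_bounds \<Omega> u0 m M"
    and "ord T \<ge> 1" and "gauss_lobatto (ord T) (gln T) (glw T)"
    and "dg_mesh T \<Omega>"
    and "entropy_pair f \<theta> g" and "twice_differentiable \<theta>" and "\<And>w. deriv (deriv \<theta>) w > 0"
    and "entropy_conservative_flux f \<theta> g hec"
    and "interface_flux f m M h" and "bound_preserving_entropy_stable f m M h Q"
    and "\<And>\<kappa>. \<kappa> \<in> elements T \<Longrightarrow>
           ereal (d \<kappa>) \<ge> 4 * flux_lipschitz f m M * entropy_ratio \<theta> m M * ereal (max_D_ratio T)"
    and "\<Delta>t > 0"
    and "dofs_in T {m..M} U" and "dofs_in T {m..M} U'"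
    and "\<And>\<kappa> i j. \<kappa> \<in> elements T \<Longrightarrow> i \<le> ord T \<Longrightarrow> j \<le> ord T \<Longrightarrow>
           glw T i * glw T j * Jdet T \<kappa> i j * ((U' \<kappa> i j - U \<kappa> i j) / \<Delta>t)
             + residual T f hec h U' \<kappa> i j + graph_viscosity T d U' \<kappa> i j = 0"
  shows "\<forall>\<eta> q. entropy_pair f \<eta> q \<and> twice_differentiable \<eta> \<and> (\<forall>w. deriv (deriv \<eta>) w \<ge> 0) \<longrightarrow>
           (\<forall>\<kappa>\<in>elements T.
              cell_average T \<eta> U' \<kappa> \<le> cell_average T \<eta> U \<kappa>
                - \<Delta>t / cell_volume T \<kappa> *
                    (\<Sum>e\<in>edges T \<kappa>. \<Sum>k\<le>ord T. glw T k * Jedge T e k *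
                       Q \<eta> q (inner_trace T U' \<kappa> e k) (outer_trace T U' \<kappa> e k) (normal T \<kappa> e k)))"
proof (intro allI impI ballI)
  fix \<eta> q \<kappa>
  assume "entropy_pair f \<eta> q \<and> twice_differentiable \<eta> \<and> (\<forall>w. deriv (deriv \<eta>) w \<ge> 0)"
    and \<kappa>: "\<kappa> \<in> elements T"
  then have q: "entropy_pair f \<eta> q" and \<eta>: "twice_differentiable \<eta>"
    and convex: "\<And>w. deriv (deriv \<eta>) w \<ge> 0" by auto
  interpret gauss_lobatto_mesh T \<Omega> using assms(3-5) by unfold_locales
  let ?p = "ord T"
  \<comment> \<open>The extended real supremum is finite: it is nonnegative and bounded by the
    Lipschitz constants of the interface flux.\<close>
  obtain L1 L2 where "flux_lipschitz f m M \<le> ereal (L1 + L2)"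
    using assms(10) by (auto simp: interface_flux_def)
  moreover have "0 \<le> flux_lipschitz f m M" by (simp add: flux_lipschitz_def)
  ultimately obtain L where L: "flux_lipschitz f m M = ereal L"
    by (cases "flux_lipschitz f m M") auto
  have d: "d \<kappa> \<ge> 4 * L * max_D_ratio T"
    by (rule viscosity_lower_bound[OF assms(7,8) L max_D_ratio_nonneg[OF assms(4,3)] assms(12)[OF \<kappa>]])
  define S where "S = (\<Sum>e\<in>edges T \<kappa>. \<Sum>k\<le>?p. glw T k * Jedge T e k *
      Q \<eta> q (inner_trace T U' \<kappa> e k) (outer_trace T U' \<kappa> e k) (normal T \<kappa> e k))"
  define W where "W i j = glw T i * glw T j * Jdet T \<kappa> i j" for i j
  define N where "N i j = residual T f hec h U' \<kappa> i j + graph_viscosity T d U' \<kappa> i j" for i j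
  have W: "W i j \<ge> 0" if "i \<le> ?p" "j \<le> ?p" for i j
    using that \<kappa> mesh gauss_lobatto_pos[OF nodes]
    by (simp add: W_def dg_mesh_def valid_elements_def less_imp_le)
  have S: "S \<le> (\<Sum>i\<le>?p. \<Sum>j\<le>?p. deriv \<eta> (U' \<kappa> i j) * N i j)"
    unfolding S_def N_def
    by (rule cell_entropy_production[where d = d, OF \<kappa> assms(15,9,7,6,8,10,11) \<eta> q convex L d])
  have "(\<Sum>i\<le>?p. \<Sum>j\<le>?p. W i j * (\<eta> (U' \<kappa> i j) - \<eta> (U \<kappa> i j)))
      \<le> (\<Sum>i\<le>?p. \<Sum>j\<le>?p. - \<Delta>t * (deriv \<eta> (U' \<kappa> i j) * N i j))"
  proof (intro sum_mono)
    fix i j assume "i \<in> {..?p}" "j \<in> {..?p}"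
    then have ij: "i \<le> ?p" "j \<le> ?p" by auto
    have "W i j * ((U' \<kappa> i j - U \<kappa> i j) / \<Delta>t) = - N i j"
      using assms(16)[OF \<kappa> ij] by (simp add: W_def N_def)
    then have step: "W i j * (U' \<kappa> i j - U \<kappa> i j) = - \<Delta>t * N i j"
      using \<open>\<Delta>t > 0\<close> by (simp add: field_simps)
    \<comment> \<open>The tangent is taken at the new value, so the increment is multiplied by the
      same \<open>deriv \<eta> (U' \<kappa> i j)\<close> that tests the residual.\<close>
    have "\<eta> (U' \<kappa> i j) - \<eta> (U \<kappa> i j) \<le> deriv \<eta> (U' \<kappa> i j) * (U' \<kappa> i j - U \<kappa> i j)"
      using convex_above_tangent[OF _ \<eta>, of "U' \<kappa> i j" "U \<kappa> i j"] q
      by (simp add: entropy_pair_def algebra_simps)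
    then have "W i j * (\<eta> (U' \<kappa> i j) - \<eta> (U \<kappa> i j))
        \<le> W i j * (deriv \<eta> (U' \<kappa> i j) * (U' \<kappa> i j - U \<kappa> i j))"
      using W[OF ij] by (rule mult_left_mono)
    also have "\<dots> = deriv \<eta> (U' \<kappa> i j) * (W i j * (U' \<kappa> i j - U \<kappa> i j))" by simp
    finally show "W i j * (\<eta> (U' \<kappa> i j) - \<eta> (U \<kappa> i j)) \<le> - \<Delta>t * (deriv \<eta> (U' \<kappa> i j) * N i j)"
      unfolding step by (simp add: mult_ac)
  qed
  also have "\<dots> = - \<Delta>t * (\<Sum>i\<le>?p. \<Sum>j\<le>?p. deriv \<eta> (U' \<kappa> i j) * N i j)"
    by (simp add: sum_distrib_left)
  also have "\<dots> \<le> - \<Delta>t * S" using S \<open>\<Delta>t > 0\<close> by simp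
  finally have ineq: "(\<Sum>i\<le>?p. \<Sum>j\<le>?p. W i j * (\<eta> (U' \<kappa> i j) - \<eta> (U \<kappa> i j))) \<le> - \<Delta>t * S" .
  have avg: "cell_average T \<eta> V \<kappa> = (\<Sum>i\<le>?p. \<Sum>j\<le>?p. W i j * \<eta> (V \<kappa> i j)) / cell_volume T \<kappa>" for V
    by (simp add: cell_average_def W_def sum_divide_distrib)
  have "cell_average T \<eta> U' \<kappa> - cell_average T \<eta> U \<kappa>
      = (\<Sum>i\<le>?p. \<Sum>j\<le>?p. W i j * (\<eta> (U' \<kappa> i j) - \<eta> (U \<kappa> i j))) / cell_volume T \<kappa>"
    by (simp add: avg right_diff_distrib sum_subtractf diff_divide_distrib)
  also have "\<dots> \<le> - \<Delta>t * S / cell_volume T \<kappa>"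
    using ineq cell_volume_pos[OF \<kappa>] by (intro divide_right_mono) auto
  finally show "cell_average T \<eta> U' \<kappa> \<le> cell_average T \<eta> U \<kappa> - \<Delta>t / cell_volume T \<kappa> *
      (\<Sum>e\<in>edges T \<kappa>. \<Sum>k\<le>?p. glw T k * Jedge T e k *
         Q \<eta> q (inner_trace T U' \<kappa> e k) (outer_trace T U' \<kappa> e k) (normal T \<kappa> e k))"
    unfolding S_def[symmetric] by simp
qed

end
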